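(* Consider the problem $\min\{f(x):x\in X\cap Y\}$ and the gradient method with randomized feasibility described in the context. Assume: (i) each $g_i:\mathbb{R}^n\to\mathbb{R}$ is convex on $\mathbb{R}^n$, $Y$ is closed and convex, and $X\cap Y$ is nonempty; (ii) there is a constant $c>0$ such that $\mathrm{dist}^2(x,X\cap Y)\le c\,\mathbb{E}_\omega[(g_\omega^+(x))^2]$ for all $x\in Y$; (iii) $f$ has Lipschitz continuous gradients over $Y$ with constant $L>0$, i.e. $f(y)-f(x)\le\langle\nabla f(x),y-x\rangle+\frac L2\|y-x\|^2$ for all $x,y\in Y$; (iv) $f$ is strongly convex over $Y$ with constant $\mu>0$, i.e. $f(y)-f(x)\ge\langle\nabla f(x),y-x\rangle+\frac\mu2\|y-x\|^2$ for all $x,y\in Y$. Let $x^*$ be the unique solution, and use a constant step size $\alpha_k=\alpha\in(0,\frac1L]$ in the method. Then: 1. For the weighted iterate $\bar v_k=\frac{\alpha\mu}{1-(1-\alpha\mu)^k}\sum_{t=2}^{k+1}(1-\alpha\mu)^{k+1-t}v_t$, $$f(\bar v_k)-f(x^* )\le\mu(1-\alpha\mu)^k\frac{\|v_1-x^*\|^2}{2(1-(1-\alpha\mu)^k)}\quad\text{surely for all }k\ge1.$$ 2. The iterates $x_k$ obtained by the randomized feasibility algorithm satisfy $$\mathbb{E}\left[f(x_k)-f(x^* )\mid\mathcal F_{k-1}\cup\{N_k\}\right]\ge-M_f(1-q)^{\frac{N_k}{2}}(B_0+\|x^*\|)\quad\text{almost surely for all }k\ge1.$$ 3. The weighted iterate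 $\bar x_k=\frac{\alpha\mu}{1-(1-\alpha\mu)^{k+1}}\sum_{t=1}^{k+1}(1-\alpha\mu)^{k+1-t}x_t$ satisfies $$\mathbb{E}\left[f(\bar x_k)-f(x^* )\right]\ge-M_f\max_{1\le t\le k+1}\mathbb{E}\left[(1-q)^{\frac{N_t}{2}}\right](B_0+\|x^*\|)\quad\text{for all }k\ge1.$$
   Context: Setting: $f,g_1,\dots,g_m:\mathbb{R}^n\to\mathbb{R}$ are convex, $\nabla f$ is the gradient of $f$, $Y\subseteq\mathbb{R}^n$, $X=\bigcap_{i=1}^m\{x\in\mathbb{R}^n: g_i(x)\le0\}$. Norms are Euclidean, $\Pi_Y$ is Euclidean projection onto $Y$, $\mathrm{dist}(x,S)=\min_{z\in S}\|z-x\|$, $g_i^+(x)=\max\{0,g_i(x)\}$. $\omega$ is a random variable taking values in $\{1,\dots,m\}$ with positive probabilities; the constant $c$ may depend on its distribution. Randomized feasibility algorithm with input $(v_k,N_k)$ and deterministic step size $0<\beta<2$: set $z_k^0=v_k$; for $i=1,\dots,N_k$ sample an index $\omega_k^i\in\{1,\dots,m\}$ uniformly, compute a subgradient $d_k^i\in\partial g^+_{\omega_k^i}(z_k^{i-1})$ and set $z_k^i=\Pi_Y\left[z_k^{i-1}-\beta\frac{g^+_{\omega_k^i}(z_k^{i-1})}{\|d_k^i\|^2}d_k^i\right]$; output $x_k=z_k^{N_k}$. The sample size $N_k$ may be deterministic or random, drawn from a distribution $\mathcal{D}_k$ on a discrete set $\mathcal{I}_k\subseteq\mathbb{N}$. Gradient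 method with randomized feasibility: start from a random $x_0\in Y$; for $k=0,1,2,\dots$ set $v_{k+1}=\Pi_Y[x_k-\alpha_k\nabla f(x_k)]$ and let $x_{k+1}$ be the output of the randomized feasibility algorithm with input $(v_{k+1},N_{k+1})$. Sigma-algebras: $\mathcal F_0=\{x_0\}$ and, for $k\ge1$, $\mathcal F_k=\{x_0\}\cup\{\omega_t^i,N_t:1\le i\le N_t,\ 1\le t\le k\}$ (meaning those generated by the listed random variables). Constants: the random initial point satisfies $\|x_0\|\le M_0$ surely for some scalar $M_0>0$; $B_0\ge M_0$ is such that $\|x\|\le B_0$ for all $x$ in the level set $\{u\in\mathbb{R}^n: f(u)\le f(x^* )\}$ (then surely $\|x_k-x^*\|$, $\|v_k-x^*\|$ and $\|z_k^i-x^*\|$ are at most $B_0+\|x^*\|$ for all $k\ge1$ and $i$); $M_f>0$ and $M_g>0$ are deterministic scalars such that surely $\|\nabla f(x_k)\|\le M_f$ for all $k\ge0$ and $\|d_k^i\|\le M_g$ for all $i=1,\dots,N_k$ and $k\ge1$ (these exist because the iterates are surely bounded); $q=\frac{\beta(2-\beta)}{cM_g^2}$.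
   Formalization: M_f is also required to bound ‖∇f(x* )‖ (with a bound only at the x_k, item 2 is false); the sampled indices have the same law as ω in (ii), uniform being a special case; μ ≤ L is assumed (automatic unless Y is a point); subgradients are chosen measurably from the past. *)

theory Defs
  imports "HOL-Probability.Probability"
begin

definition pos_part :: "('a \<Rightarrow> real) \<Rightarrow> 'a \<Rightarrow> real" where
  "pos_part h x = max 0 (h x)"

definition subdifferential :: "('a::real_inner \<Rightarrow> real) \<Rightarrow> 'a \<Rightarrow> 'a set" where
  "subdifferential h x = {d. \<forall>y. h y \<ge> h x + d \<bullet> (y - x)}"

definition feasible_set :: "nat \<Rightarrow> (nat \<Rightarrow> 'a \<Rightarrow> real) \<Rightarrow> 'a set" where
  "feasible_set m g = (\<Inter>i\<in>{1..m}. {x. g i x \<le> 0})"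

text \<open>The two predicates below describe one realisation: \<open>w\<close>, \<open>d\<close>, \<open>N\<close> are the realised
  indices, subgradients and sample sizes. If \<open>d i = 0\<close> then, whenever the constraints have a common
  feasible point, the positive part vanishes at \<open>z (i - 1)\<close>, and \<open>0 / 0 = 0\<close> makes the step
  the identity on \<open>Y\<close>.\<close>

definition feasibility_run ::
  "'a::euclidean_space set \<Rightarrow> (nat \<Rightarrow> 'a \<Rightarrow> real) \<Rightarrow> real \<Rightarrow> 'a \<Rightarrow> nat \<Rightarrow>
    (nat \<Rightarrow> nat) \<Rightarrow> (nat \<Rightarrow> 'a) \<Rightarrow> (nat \<Rightarrow> 'a) \<Rightarrow> bool" where
  "feasibility_run Y g \<beta> v n w d z \<longleftrightarrow>
     z 0 = v \<and>
     (\<forall>i\<in>{1..n}.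
        d i \<in> subdifferential (pos_part (g (w i))) (z (i - 1)) \<and>
        z i = closest_point Y
          (z (i - 1) - (\<beta> * (pos_part (g (w i)) (z (i - 1)) / (norm (d i))\<^sup>2)) *\<^sub>R d i))"

definition gradient_feasibility_run ::
  "'a::euclidean_space set \<Rightarrow> (nat \<Rightarrow> 'a \<Rightarrow> real) \<Rightarrow> ('a \<Rightarrow> 'a) \<Rightarrow> (nat \<Rightarrow> real) \<Rightarrow> real \<Rightarrow>
    (nat \<Rightarrow> nat) \<Rightarrow> (nat \<Rightarrow> nat \<Rightarrow> nat) \<Rightarrow> (nat \<Rightarrow> nat \<Rightarrow> 'a) \<Rightarrow>
    (nat \<Rightarrow> 'a) \<Rightarrow> (nat \<Rightarrow> 'a) \<Rightarrow> (nat \<Rightarrow> nat \<Rightarrow> 'a) \<Rightarrow> bool" where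
  "gradient_feasibility_run Y g gradf \<alpha> \<beta> N w d x v z \<longleftrightarrow>
     x 0 \<in> Y \<and>
     (\<forall>k. v (Suc k) = closest_point Y (x k - \<alpha> k *\<^sub>R gradf (x k)) \<and>
          feasibility_run Y g \<beta> (v (Suc k)) (N (Suc k)) (w (Suc k)) (d (Suc k)) (z (Suc k)) \<and>
          x (Suc k) = z (Suc k) (N (Suc k)))"

text \<open>Generating events of the sigma-algebra of \<open>x0\<close> and of all \<open>N t\<close> and \<open>w t i\<close> with
  \<open>1 \<le> i \<le> N t\<close> and \<open>1 \<le> t \<le> k\<close>. As \<open>N t\<close> may be random, the index \<open>w t i\<close> is visible only on
  the event that it is really drawn.\<close>

definition history_events ::
  "'s measure \<Rightarrow> ('s \<Rightarrow> 'a::topological_space) \<Rightarrow> (nat \<Rightarrow> 's \<Rightarrow> nat) \<Rightarrow>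
    (nat \<Rightarrow> nat \<Rightarrow> 's \<Rightarrow> nat) \<Rightarrow> nat \<Rightarrow> 's set set" where
  "history_events M x0 N w k =
     {x0 -` A \<inter> space M | A. A \<in> sets borel} \<union>
     {{s \<in> space M. N t s = n} | t n. t \<in> {1..k}} \<union>
     {{s \<in> space M. i \<le> N t s \<and> w t i s = j} | t i j. t \<in> {1..k} \<and> 1 \<le> i}"

text \<open>Information available in outer iteration \<open>k\<close> after the sample size \<open>N k\<close> and the first \<open>i\<close>
  indices of that iteration are known; \<open>stage_algebra M x0 N w k 0\<close> is generated by the history
  up to \<open>k - 1\<close> together with \<open>N k\<close>.\<close>

definition stage_algebra ::
  "'s measure \<Rightarrow> ('s \<Rightarrow> 'a::topological_space) \<Rightarrow> (nat \<Rightarrow> 's \<Rightarrow> nat) \<Rightarrow>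
    (nat \<Rightarrow> nat \<Rightarrow> 's \<Rightarrow> nat) \<Rightarrow> nat \<Rightarrow> nat \<Rightarrow> 's measure" where
  "stage_algebra M x0 N w k i = sigma (space M)
     (history_events M x0 N w (k - 1) \<union>
      {{s \<in> space M. N k s = n} | n. True} \<union>
      {{s \<in> space M. l \<le> N k s \<and> w k l s = j} | l j. l \<in> {1..i}})"

text \<open>Outer iterations \<open>k\<close> and inner iterations \<open>i\<close> count from 1. Each index \<open>w k i\<close> has law \<open>p\<close>
  and is independent of everything known before it is drawn (hence of \<open>x0\<close>, of the earlier
  iterations and of \<open>N k\<close>). \<open>N k\<close> is an arbitrary random natural number, constants included.
  Subgradients are computed from what is known when they are needed.\<close>

definition sampling_scheme ::
  "'s measure \<Rightarrow> nat pmf \<Rightarrow> ('s \<Rightarrow> 'a::euclidean_space) \<Rightarrow> (nat \<Rightarrow> 's \<Rightarrow> nat) \<Rightarrow>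
    (nat \<Rightarrow> nat \<Rightarrow> 's \<Rightarrow> nat) \<Rightarrow> (nat \<Rightarrow> nat \<Rightarrow> 's \<Rightarrow> 'a) \<Rightarrow> bool" where
  "sampling_scheme M p x0 N w d \<longleftrightarrow>
     x0 \<in> borel_measurable M \<and>
     (\<forall>k\<ge>1. N k \<in> measurable M (count_space UNIV)) \<and>
     (\<forall>k\<ge>1. \<forall>i\<ge>1.
        w k i \<in> measurable M (count_space UNIV) \<and>
        distr M (count_space UNIV) (w k i) = measure_pmf p \<and>
        (\<forall>s\<in>space M. w k i s \<in> set_pmf p) \<and>
        prob_space.indep_set M
          (sets (vimage_algebra (space M) (w k i) (count_space UNIV)))
          (sets (stage_algebra M x0 N w k (i - 1))) \<and>
        (\<lambda>s. if i \<le> N k s then d k i s else 0) \<in> borel_measurable (stage_algebra M x0 N w k i))"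

text \<open>\<open>half_pow a n\<close> is the real power of \<open>a\<close> with exponent \<open>n / 2\<close>. The operator \<open>powr\<close> is
  avoided because \<open>0 powr 0 = 0\<close>. For negative \<open>a\<close>, where no real power exists, the value is that
  for \<open>a = 0\<close>.\<close>

definition half_pow :: "real \<Rightarrow> nat \<Rightarrow> real" where
  "half_pow a n = sqrt (max 0 a) ^ n"

lemma half_pow_eq_powr: "0 \<le> a \<Longrightarrow> 0 < n \<Longrightarrow> half_pow a n = a powr (real n / 2)"
  by (cases "a = 0")
    (simp_all add: half_pow_def powr_half_sqrt [symmetric] powr_powr powr_realpow [symmetric])

lemma half_pow_0: "half_pow a 0 = 1"
  by (simp add: half_pow_def)

end

theory Submission
  imports Defs
begin

text \<open>
  The smoothness inequality at \<open>x k\<close>, the strong convexity inequality at \<open>x k\<close> and the projection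
  inequality combine to
  \<open>|v (k+1) - x*|^2 + 2\<alpha> (f (v (k+1)) - f x*) \<le> (1 - \<alpha>\<mu>) |x k - x*|^2\<close>. As feasibility steps do not
  increase the distance to \<open>x*\<close>, these inequalities telescope with geometric weights, and convexity
  of \<open>f\<close> gives the upper bound. They also keep all iterates within \<open>R = B\<^sub>0 + |x*|\<close> of \<open>x*\<close>.

  For the lower bounds let \<open>D\<close> be the distance to \<open>X \<inter> Y\<close>. By optimality of \<open>x*\<close>,
  \<open>f u - f x* \<ge> - M\<^sub>f D u\<close> on \<open>Y\<close>. A feasibility step decreases \<open>D\<^sup>2\<close> by at least a multiple of the
  squared violation of the drawn constraint; as the index is independent of the past, the regularity
  condition makes the step contract \<open>E D\<^sup>2\<close> by the factor \<open>1 - q\<close> on every event known before it. On events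
  on which \<open>N k = n\<close> this can be iterated \<open>n\<close> times, and Jensen's inequality bounds \<open>E D\<close>.
\<close>

section \<open>Geometric sums and the inequalities for a single step\<close>

lemma sum_power_diff:
  fixes a :: "'a::field"
  assumes "l \<le> Suc n" "a \<noteq> 1"
  shows "(\<Sum>t=l..n. a ^ (n - t)) = (1 - a ^ (Suc n - l)) / (1 - a)"
proof -
  have "(\<Sum>t=l..n. a ^ (n - t)) = (\<Sum>i<Suc n - l. a ^ i)"
    by (rule sum.reindex_bij_witness[where i = "\<lambda>i. n - i" and j = "\<lambda>t. n - t"]) (use assms in auto)
  then show ?thesis
    using assms(2) by (simp add: sum_gp_strict)
qed

lemma norm_closest_point_diff_le:
  fixes Y :: "'a::euclidean_space set"
  assumes "closed Y" "convex Y" "y \<in> Y"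
  shows "norm (closest_point Y u - y) \<le> norm (u - y)"
  using closest_point_lipschitz[OF assms(2,1), of u y] assms(3)
  by (metis closest_point_self dist_norm empty_iff)

text \<open>This is a relaxed Polyak step. The subgradient inequality at \<open>y\<close>, where the
  positive part vanishes, gives \<open>pos_part h u \<le> d \<bullet> (u - y)\<close>. Expanding the
  square then leaves a gain of \<open>\<beta> * (2 - \<beta>)\<close> times the squared violation
  over the squared norm of \<open>d\<close>, and projecting onto \<open>Y\<close> does not move the
  point away from \<open>y\<close>.\<close>

lemma norm_feasibility_step_le:
  fixes Y :: "'a::euclidean_space set"
  assumes Y: "closed Y" "convex Y" "y \<in> Y"
    and y: "h y \<le> 0"
    and d: "d \<in> subdifferential (pos_part h) u" "norm d \<le> B"
    and \<beta>: "0 < \<beta>" "\<beta> < 2"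
  shows "(norm (closest_point Y (u - (\<beta> * (pos_part h u / (norm d)\<^sup>2)) *\<^sub>R d) - y))\<^sup>2
    \<le> (norm (u - y))\<^sup>2 - \<beta> * (2 - \<beta>) / B\<^sup>2 * (pos_part h u)\<^sup>2"
proof -
  define G where "G = pos_part h u"
  define s where "s = G / (norm d)\<^sup>2"
  have G0: "0 \<le> G" by (simp add: G_def pos_part_def)
  then have s0: "0 \<le> s" by (simp add: s_def)
  have "pos_part h y = 0" using y by (simp add: pos_part_def)
  then have sub: "G \<le> d \<bullet> (u - y)"
    using d(1) unfolding subdifferential_def G_def
    by (auto simp: inner_diff_right dest!: spec[of _ y])
  \<comment> \<open>If \<open>d = 0\<close>, then \<open>sub\<close> forces \<open>G = 0\<close> and
    both sides vanish; otherwise \<open>B\<close> is positive because it bounds the norm of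
    \<open>d\<close>.\<close>
  have low: "G\<^sup>2 / B\<^sup>2 \<le> s * G"
  proof (cases "d = 0")
    case True
    then show ?thesis using sub G0 by simp
  next
    case False
    then have "G\<^sup>2 / B\<^sup>2 \<le> G\<^sup>2 / (norm d)\<^sup>2"
      by (intro divide_left_mono) (use d(2) in \<open>auto intro!: power_mono mult_pos_pos simp: less_le_trans[of 0 "norm d" B]\<close>)
    then show ?thesis by (simp add: s_def power2_eq_square)
  qed
  have ss: "s\<^sup>2 * (norm d)\<^sup>2 = s * G"
    using sub G0 by (cases "d = 0") (auto simp: s_def power2_eq_square)
  have "(norm (closest_point Y (u - (\<beta> * s) *\<^sub>R d) - y))\<^sup>2 \<le> (norm (u - (\<beta> * s) *\<^sub>R d - y))\<^sup>2"
    using norm_closest_point_diff_le[OF Y] by (simp add: power_mono)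
  also have "\<dots> = (norm (u - y))\<^sup>2 - 2 * (\<beta> * s) * (d \<bullet> (u - y)) + \<beta>\<^sup>2 * (s\<^sup>2 * (norm d)\<^sup>2)"
    unfolding power2_norm_eq_inner
    by (simp add: inner_diff_left inner_diff_right inner_commute algebra_simps power2_eq_square)
  also have "\<dots> \<le> (norm (u - y))\<^sup>2 - 2 * (\<beta> * s) * G + \<beta>\<^sup>2 * (s * G)"
    unfolding ss using sub s0 \<beta> by (simp add: mult_left_mono)
  also have "\<dots> = (norm (u - y))\<^sup>2 - \<beta> * (2 - \<beta>) * (s * G)"
    by (simp add: algebra_simps power2_eq_square)
  also have "\<dots> \<le> (norm (u - y))\<^sup>2 - \<beta> * (2 - \<beta>) * (G\<^sup>2 / B\<^sup>2)"
    using mult_left_mono[OF low, of "\<beta> * (2 - \<beta>)"] \<beta> by simp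
  finally show ?thesis by (simp add: G_def s_def)
qed

text \<open>Smoothness is used from \<open>u\<close> to \<open>v\<close>, strong convexity from
  \<open>u\<close> to \<open>y\<close>, and the variational inequality of the projection bounds the
  remaining linear term. The projection contributes minus the squared norm of \<open>v - u\<close>,
  which absorbs the smoothness error because \<open>\<alpha> * L \<le> 1\<close>.\<close>

lemma projected_gradient_step:
  fixes Y :: "'a::euclidean_space set"
  assumes Y: "closed Y" "convex Y" "u \<in> Y" "y \<in> Y"
    and smooth: "\<And>u y. u \<in> Y \<Longrightarrow> y \<in> Y \<Longrightarrow>
      f y - f u \<le> gradf u \<bullet> (y - u) + L / 2 * (norm (y - u))\<^sup>2"
    and strong: "\<And>u y. u \<in> Y \<Longrightarrow> y \<in> Y \<Longrightarrow>
      f y - f u \<ge> gradf u \<bullet> (y - u) + \<mu> / 2 * (norm (y - u))\<^sup>2"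
    and \<alpha>: "0 < \<alpha>" "\<alpha> * L \<le> 1"
    and v: "v = closest_point Y (u - \<alpha> *\<^sub>R gradf u)"
  shows "(norm (v - y))\<^sup>2 + 2 * \<alpha> * (f v - f y) \<le> (1 - \<alpha> * \<mu>) * (norm (u - y))\<^sup>2"
proof -
  have vY: "v \<in> Y" unfolding v using Y by (auto intro: closest_point_in_set)
  have "(u - \<alpha> *\<^sub>R gradf u - v) \<bullet> (y - v) \<le> 0"
    unfolding v by (rule closest_point_dot) (use Y in auto)
  then have proj: "2 * \<alpha> * (gradf u \<bullet> (v - y))
      \<le> (norm (u - y))\<^sup>2 - (norm (v - u))\<^sup>2 - (norm (v - y))\<^sup>2"
    unfolding power2_norm_eq_inner
    by (simp add: inner_diff_left inner_diff_right inner_commute algebra_simps)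
  have "f v - f y \<le> gradf u \<bullet> (v - y) + L / 2 * (norm (v - u))\<^sup>2 - \<mu> / 2 * (norm (y - u))\<^sup>2"
    using smooth[OF Y(3) vY] strong[OF Y(3,4)] by (simp add: inner_diff_right)
  then have "2 * \<alpha> * (f v - f y)
      \<le> 2 * \<alpha> * (gradf u \<bullet> (v - y) + L / 2 * (norm (v - u))\<^sup>2 - \<mu> / 2 * (norm (y - u))\<^sup>2)"
    using \<alpha>(1) by (intro mult_left_mono) auto
  also have "\<dots> = 2 * \<alpha> * (gradf u \<bullet> (v - y)) + \<alpha> * L * (norm (v - u))\<^sup>2
      - \<alpha> * \<mu> * (norm (u - y))\<^sup>2"
    by (simp add: algebra_simps norm_minus_commute)
  also have "\<dots> \<le> 2 * \<alpha> * (gradf u \<bullet> (v - y)) + (norm (v - u))\<^sup>2 - \<alpha> * \<mu> * (norm (u - y))\<^sup>2"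
    using mult_right_mono[OF \<alpha>(2), of "(norm (v - u))\<^sup>2"] by simp
  finally show ?thesis
    using proj by (simp add: algebra_simps)
qed

section \<open>First-order optimality and measurability of gradients\<close>

lemma GDERIV_imp_DERIV_along:
  assumes "GDERIV f u :> D"
  shows "((\<lambda>t. f (u + t *\<^sub>R h)) has_real_derivative D \<bullet> h) (at 0)"
proof -
  have 1: "((\<lambda>t::real. u + t *\<^sub>R h) has_derivative (\<lambda>t. t *\<^sub>R h)) (at 0)"
    by (auto intro!: derivative_eq_intros)
  have "(f has_derivative (\<lambda>h. h \<bullet> D)) (at (u + 0 *\<^sub>R h))"
    using assms by (simp add: gderiv_def)
  from has_derivative_compose[OF 1 this]
  show ?thesis
    by (simp add: has_field_derivative_def mult_commute_abs inner_commute[of h])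
qed

text \<open>A negative directional derivative towards \<open>y\<close> would make a short move along
  the segment decrease \<open>f\<close> without leaving \<open>C\<close>.\<close>

lemma is_arg_min_GDERIV_nonneg:
  fixes f :: "'a::real_inner \<Rightarrow> real"
  assumes C: "convex C" and min: "is_arg_min f (\<lambda>u. u \<in> C) x" and "GDERIV f x :> D" and y: "y \<in> C"
  shows "0 \<le> D \<bullet> (y - x)"
proof (rule ccontr)
  assume "\<not> ?thesis"
  then obtain e where e: "e > 0"
      "\<And>h. 0 < h \<Longrightarrow> 0 + h < 0 + e \<Longrightarrow> f (x + (0 + h) *\<^sub>R (y - x)) < f (x + 0 *\<^sub>R (y - x))"
    using DERIV_neg_dec_right[OF GDERIV_imp_DERIV_along[OF assms(3)], of "y - x"] by force
  \<comment> \<open>The bound 1 keeps the point on the segment, and \<open>e / 2\<close> keeps it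
    where \<open>f\<close> is strictly smaller.\<close>
  define h where "h = min 1 (e / 2)"
  have h: "0 < h" "h \<le> 1" "h < e" using e(1) by (auto simp: h_def)
  have "x \<in> C" using min by (simp add: is_arg_min_def)
  then have "x + h *\<^sub>R (y - x) \<in> C"
    using convexD_alt[OF C _ y, of x h] h by (simp add: algebra_simps)
  moreover have "f (x + h *\<^sub>R (y - x)) < f x"
    using e(2)[of h] h by simp
  ultimately show False
    using min by (auto simp: is_arg_min_def)
qed

text \<open>Each component of the gradient is a pointwise limit of difference quotients of the
  continuous function \<open>f\<close>, taken with increments \<open>1 / (n + 1)\<close>.\<close>

lemma borel_measurable_GDERIV:
  fixes f :: "'a::euclidean_space \<Rightarrow> real"
  assumes f: "\<And>u. GDERIV f u :> D u"
  shows "D \<in> borel_measurable borel"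
proof -
  have "continuous_on UNIV f"
    using f by (auto simp: continuous_on_eq_continuous_at gderiv_def intro: has_derivative_continuous)
  then have [measurable]: "f \<in> borel_measurable borel"
    by (rule borel_measurable_continuous_onI)
  have "(\<lambda>u. D u \<bullet> b) \<in> borel_measurable borel" for b
  proof (rule borel_measurable_LIMSEQ_real)
    fix u
    have "((\<lambda>t. (f (u + t *\<^sub>R b) - f u) / t) \<longlongrightarrow> D u \<bullet> b) (at 0)"
      using GDERIV_imp_DERIV_along[OF f, of u b] by (simp add: has_field_derivative_iff)
    moreover have "filterlim (\<lambda>n. inverse (real (Suc n))) (at 0) sequentially"
      using LIMSEQ_inverse_real_of_nat by (auto simp: filterlim_at)
    ultimately show "(\<lambda>n. (f (u + inverse (real (Suc n)) *\<^sub>R b) - f u) / inverse (real (Suc n)))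
        \<longlonglongrightarrow> D u \<bullet> b"
      by (rule filterlim_compose)
  qed measurable
  then show ?thesis
    by (subst borel_measurable_euclidean_space) blast
qed

section \<open>Integration and conditional expectation\<close>

text \<open>The values of \<open>u\<close> lie in a closed ball; it is compact, so \<open>h\<close>
  is bounded on it.\<close>

lemma (in finite_measure) integrable_continuous_of_bounded:
  fixes u :: "'a \<Rightarrow> 'b::euclidean_space" and h :: "'b \<Rightarrow> real"
  assumes [measurable]: "u \<in> borel_measurable M" and h: "continuous_on UNIV h"
    and bd: "\<And>s. s \<in> space M \<Longrightarrow> norm (u s - y) \<le> R"
  shows "integrable M (\<lambda>s. h (u s))"
proof -
  have "bounded (h ` cball y R)"
    using h by (intro compact_imp_bounded compact_continuous_image) (auto intro: continuous_on_subset)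
  then obtain B where B: "\<And>z. z \<in> cball y R \<Longrightarrow> norm (h z) \<le> B"
    unfolding bounded_iff by blast
  have [measurable]: "h \<in> borel_measurable borel"
    using h by (rule borel_measurable_continuous_onI)
  show ?thesis
    using B bd by (intro integrable_const_bound[where B = B]) (auto simp: dist_norm norm_minus_commute)
qed

text \<open>Splitting over the finitely many values of \<open>W\<close> freezes the index: on
  \<open>W = j\<close> the integrand is \<open>H j\<close>, which is \<open>F\<close>-measurable and
  hence independent of the indicator of that event.\<close>

lemma (in prob_space) expectation_indep_index:
  fixes H :: "'b \<Rightarrow> 'a \<Rightarrow> real"
  assumes F: "subalgebra M F"
    and W: "W \<in> measurable M (count_space UNIV)"
    and indep: "indep_set (sets (vimage_algebra (space M) W (count_space UNIV))) (sets F)"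
    and J: "finite J" "\<And>s. s \<in> space M \<Longrightarrow> W s \<in> J"
    and H: "\<And>j. j \<in> J \<Longrightarrow> H j \<in> borel_measurable F" "\<And>j. j \<in> J \<Longrightarrow> integrable M (H j)"
  shows "integrable M (\<lambda>s. H (W s) s)"
    and "expectation (\<lambda>s. H (W s) s) = (\<Sum>j\<in>J. prob {s\<in>space M. W s = j} * expectation (H j))"
proof -
  note [measurable] = W
  let ?I = "\<lambda>j s. indicator {s\<in>space M. W s = j} s :: real"
  have ind: "integrable M (\<lambda>s. ?I j s * H j s) \<and>
      expectation (\<lambda>s. ?I j s * H j s) = prob {s\<in>space M. W s = j} * expectation (H j)"
    if j: "j \<in> J" for j
  proof -
    have [measurable]: "H j \<in> borel_measurable M"
      using F H(1)[OF j] by (rule measurable_from_subalg)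
    \<comment> \<open>The sigma-algebras generated by the two variables lie in that of
      \<open>W\<close> and in \<open>F\<close>, which are independent.\<close>
    have "indep_var borel (?I j) borel (H j)"
      unfolding indep_var_eq
    proof (intro conjI)
      have "?I j \<in> borel_measurable (vimage_algebra (space M) W (count_space UNIV))"
        using in_vimage_algebra[of "{j}" "count_space UNIV" W "space M"]
        by (intro borel_measurable_indicator) (simp add: vimage_def Int_def conj_commute)
      then have 1: "{?I j -` A \<inter> space M |A. A \<in> sets borel}
          \<subseteq> sets (vimage_algebra (space M) W (count_space UNIV))"
        by (auto simp: measurable_def)
      have 2: "{H j -` A \<inter> space M |A. A \<in> sets borel} \<subseteq> sets F"
        using H(1)[OF j] F by (auto simp: measurable_def subalgebra_def)
      have sub: "sigma_sets (space M) {?I j -` A \<inter> space M |A. A \<in> sets borel}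
          \<subseteq> sets (vimage_algebra (space M) W (count_space UNIV))"
        using sets.sigma_sets_subset[OF 1] by simp
      have sub': "sigma_sets (space M) {H j -` A \<inter> space M |A. A \<in> sets borel} \<subseteq> sets F"
        using sets.sigma_sets_subset[OF 2] F by (simp add: subalgebra_def)
      show "indep_set (sigma_sets (space M) {?I j -` A \<inter> space M |A. A \<in> sets borel})
        (sigma_sets (space M) {H j -` A \<inter> space M |A. A \<in> sets borel})"
        using indep unfolding indep_set_def
        by (rule indep_sets_mono_sets) (use sub sub' in \<open>auto split: bool.split\<close>)
    qed measurable
    moreover have "integrable M (?I j)"
      by (intro integrable_real_indicator) (auto simp: emeasure_eq_measure)
    ultimately show ?thesis
      using indep_var_lebesgue_integral[of "?I j" "H j"] indep_var_integrable[of "?I j" "H j"] H(2)[OF j]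
      by simp
  qed
  have eq: "(\<Sum>j\<in>J. ?I j s * H j s) = H (W s) s" if "s \<in> space M" for s
  proof -
    have "(\<Sum>j\<in>J. ?I j s * H j s) = (\<Sum>j\<in>J. if j = W s then H j s else 0)"
      by (rule sum.cong) (use that in auto)
    then show ?thesis using J that by simp
  qed
  have "integrable M (\<lambda>s. \<Sum>j\<in>J. ?I j s * H j s)"
    using ind by (intro Bochner_Integration.integrable_sum) auto
  then show "integrable M (\<lambda>s. H (W s) s)"
    using eq by (simp cong: Bochner_Integration.integrable_cong)
  have "expectation (\<lambda>s. H (W s) s) = expectation (\<lambda>s. \<Sum>j\<in>J. ?I j s * H j s)"
    using eq by (intro Bochner_Integration.integral_cong) auto
  also have "\<dots> = (\<Sum>j\<in>J. expectation (\<lambda>s. ?I j s * H j s))"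
    using ind by (intro Bochner_Integration.integral_sum) auto
  finally show "expectation (\<lambda>s. H (W s) s) = (\<Sum>j\<in>J. prob {s\<in>space M. W s = j} * expectation (H j))"
    using ind by simp
qed

text \<open>Jensen's inequality by way of \<open>D \<le> (D\<^sup>2 / \<epsilon> + \<epsilon>) / 2\<close> with \<open>\<epsilon> \<down> b\<close>.\<close>

lemma (in finite_measure) integral_indicator_le_of_square:
  fixes D :: "'a \<Rightarrow> real"
  assumes A: "A \<in> sets M" and int: "integrable M (\<lambda>s. indicator A s * D s)"
      "integrable M (\<lambda>s. indicator A s * (D s)\<^sup>2)"
    and b: "0 \<le> b" "(\<integral>s. indicator A s * (D s)\<^sup>2 \<partial>M) \<le> b\<^sup>2 * measure M A"
  shows "(\<integral>s. indicator A s * D s \<partial>M) \<le> b * measure M A"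
proof -
  have *: "(\<integral>s. indicator A s * D s \<partial>M) \<le> \<epsilon> * measure M A" if "b < \<epsilon>" for \<epsilon>
  proof -
    have \<epsilon>: "0 < \<epsilon>" using b(1) that by simp
    have amgm: "D s \<le> (D s)\<^sup>2 / (2 * \<epsilon>) + \<epsilon> / 2" for s
      using zero_le_power2[of "D s - \<epsilon>"] \<epsilon> by (simp add: field_simps power2_eq_square)
    have "(\<integral>s. indicator A s * D s \<partial>M)
        \<le> (\<integral>s. (indicator A s * (D s)\<^sup>2) / (2 * \<epsilon>) + \<epsilon> / 2 * indicator A s \<partial>M)"
    proof (intro integral_mono int(1) Bochner_Integration.integrable_add)
      show "integrable M (\<lambda>s. indicator A s * (D s)\<^sup>2 / (2 * \<epsilon>))"
        using int(2) by simp
      show "integrable M (\<lambda>s. \<epsilon> / 2 * indicator A s)"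
        using A by (intro integrable_mult_right integrable_real_indicator) (auto simp: emeasure_eq_measure)
    qed (use amgm in \<open>auto simp: indicator_def\<close>)
    also have "\<dots> = (\<integral>s. indicator A s * (D s)\<^sup>2 \<partial>M) / (2 * \<epsilon>) + \<epsilon> / 2 * measure M A"
      using A int(2) by (subst Bochner_Integration.integral_add)
        (auto simp: emeasure_eq_measure)
    also have "\<dots> \<le> \<epsilon>\<^sup>2 * measure M A / (2 * \<epsilon>) + \<epsilon> / 2 * measure M A"
    proof -
      have "b\<^sup>2 * measure M A \<le> \<epsilon>\<^sup>2 * measure M A"
        using that b(1) by (intro mult_right_mono power_mono) auto
      then show ?thesis
        using b(2) \<epsilon> by (intro add_mono divide_right_mono) auto
    qed
    also have "\<dots> = \<epsilon> * measure M A"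
      using \<epsilon> by (simp add: field_simps power2_eq_square)
    finally show ?thesis .
  qed
  have "((\<lambda>\<epsilon>. \<epsilon> * measure M A) \<longlongrightarrow> b * measure M A) (at_right b)"
    by (intro tendsto_intros)
  then show ?thesis
    by (rule tendsto_lowerbound) (use * in \<open>auto simp: eventually_at_right_less eventually_at_filter\<close>)
qed

text \<open>As \<open>N\<close> takes countably many values, it suffices to treat each event
  \<open>N = n\<close> separately. Integrating over the part of it where the bound fails shows that
  this part is a null set.\<close>

lemma (in finite_measure) real_cond_exp_le_of_integral_le:
  fixes G h :: "'a \<Rightarrow> real" and N :: "'a \<Rightarrow> nat"
  assumes F: "subalgebra M F" and N: "N \<in> measurable F (count_space UNIV)"
    and G: "integrable M G"
    and le: "\<And>A n. A \<in> sets F \<Longrightarrow> (\<And>s. s \<in> A \<Longrightarrow> N s = n) \<Longrightarrow>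
      (\<integral>s. indicator A s * G s \<partial>M) \<le> b n * measure M A"
  shows "AE s in M. real_cond_exp M F G s \<le> b (N s)"
proof -
  interpret finite_measure_subalgebra M F
    by standard (rule F)
  have sp: "space F = space M" using F by (simp add: subalgebra_def)
  have "AE s in M. N s = n \<longrightarrow> real_cond_exp M F G s \<le> b n" for n
  proof -
    define A where "A = {s \<in> space F. N s = n \<and> real_cond_exp M F G s > b n}"
    have AF: "A \<in> sets F" unfolding A_def using N by measurable
    then have A: "A \<in> sets M" using F by (auto simp: subalgebra_def)
    \<comment> \<open>The excess is nonnegative by the choice of \<open>A\<close>, while the
      hypothesis on \<open>G\<close>, tested on \<open>A\<close>, makes its integral at most 0.
      Hence it vanishes almost everywhere, although it is strictly positive on
      \<open>A\<close>.\<close>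
    let ?K = "\<lambda>s. indicator A s * (real_cond_exp M F G s - b n)"
    have i1: "integrable M (\<lambda>s. indicator A s * real_cond_exp M F G s)"
      using integrable_mult_indicator[OF A real_cond_exp_int(1)[OF G]] by simp
    have i2: "integrable M (\<lambda>s. indicator A s * b n)"
      using A by (auto simp: emeasure_eq_measure)
    have iK: "integrable M ?K"
      using Bochner_Integration.integrable_diff[OF i1 i2] by (simp add: right_diff_distrib)
    have "integral\<^sup>L M ?K = (\<integral>s. indicator A s * real_cond_exp M F G s \<partial>M) - b n * measure M A"
      using Bochner_Integration.integral_diff[OF i1 i2] A by (simp add: right_diff_distrib)
    also have "(\<integral>s. indicator A s * real_cond_exp M F G s \<partial>M) = (\<integral>s. indicator A s * G s \<partial>M)"
      using real_cond_exp_intA[OF G AF] by (simp add: set_lebesgue_integral_def)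
    also have "\<dots> - b n * measure M A \<le> 0"
      using le[OF AF, of n] by (auto simp: A_def)
    finally have "integral\<^sup>L M ?K \<le> 0" .
    moreover have nn: "AE s in M. 0 \<le> ?K s" by (auto simp: A_def indicator_def)
    ultimately have "integral\<^sup>L M ?K = 0"
      using integral_nonneg_AE[OF nn] by simp
    then have "AE s in M. ?K s = 0"
      using integral_nonneg_eq_0_iff_AE[OF iK nn] by simp
    then show ?thesis
    proof (rule AE_mp, intro AE_I2 impI)
      fix s assume "s \<in> space M" "?K s = 0" "N s = n"
      then show "real_cond_exp M F G s \<le> b n"
        by (auto simp: A_def sp indicator_def split: if_splits)
    qed
  qed
  then have "AE s in M. \<forall>n. N s = n \<longrightarrow> real_cond_exp M F G s \<le> b n"
    unfolding AE_all_countable by blast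
  then show ?thesis by (rule AE_mp) simp
qed

section \<open>Pathwise estimates\<close>

text \<open>\<open>R\<close> stands for \<open>B\<^sub>0 + norm xstar\<close>.\<close>

locale randomized_feasibility_gradient = prob_space M
  for M :: "'s measure" +
  fixes f :: "'a::euclidean_space \<Rightarrow> real" and gradf :: "'a \<Rightarrow> 'a"
    and m :: nat and g :: "nat \<Rightarrow> 'a \<Rightarrow> real"
    and X Y :: "'a set" and xstar :: 'a
    and p :: "nat pmf"
    and c L \<mu> \<alpha> \<beta> R M\<^sub>f M\<^sub>g q :: real
    and N :: "nat \<Rightarrow> 's \<Rightarrow> nat"
    and w :: "nat \<Rightarrow> nat \<Rightarrow> 's \<Rightarrow> nat"
    and d z :: "nat \<Rightarrow> nat \<Rightarrow> 's \<Rightarrow> 'a"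
    and x v :: "nat \<Rightarrow> 's \<Rightarrow> 'a"
  assumes f_convex: "convex_on UNIV f"
    and f_grad: "\<And>u. GDERIV f u :> gradf u"
    and X_def: "X = feasible_set m g"
    and g_convex: "\<And>i. i \<in> {1..m} \<Longrightarrow> convex_on UNIV (g i)"
    and Y: "closed Y" "convex Y"
    and p_pos: "set_pmf p = {1..m}"
    and c: "c > 0"
      "\<And>u. u \<in> Y \<Longrightarrow> (infdist u (X \<inter> Y))\<^sup>2
                \<le> c * measure_pmf.expectation p (\<lambda>j. (pos_part (g j) u)\<^sup>2)"
    and smooth: "L > 0"
      "\<And>u y. u \<in> Y \<Longrightarrow> y \<in> Y \<Longrightarrow> f y - f u \<le> gradf u \<bullet> (y - u) + L / 2 * (norm (y - u))\<^sup>2"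
    and strongly_convex: "\<mu> > 0"
      "\<And>u y. u \<in> Y \<Longrightarrow> y \<in> Y \<Longrightarrow> f y - f u \<ge> gradf u \<bullet> (y - u) + \<mu> / 2 * (norm (y - u))\<^sup>2"
    and mu_le_L: "\<mu> \<le> L"
    and solution: "is_arg_min f (\<lambda>u. u \<in> X \<inter> Y) xstar"
    and step_sizes: "0 < \<alpha>" "\<alpha> \<le> 1 / L" "0 < \<beta>" "\<beta> < 2"
    and sampling: "sampling_scheme M p (x 0) N w d"
    and run: "\<And>s. s \<in> space M \<Longrightarrow> gradient_feasibility_run Y g gradf (\<lambda>_. \<alpha>) \<beta>
        (\<lambda>k. N k s) (\<lambda>k i. w k i s) (\<lambda>k i. d k i s)
        (\<lambda>k. x k s) (\<lambda>k. v k s) (\<lambda>k i. z k i s)"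
    and R: "R > 0" "\<And>s. s \<in> space M \<Longrightarrow> norm (x 0 s - xstar) \<le> R"
      "\<And>u. f u \<le> f xstar \<Longrightarrow> norm (u - xstar) \<le> R"
    and M\<^sub>f: "norm (gradf xstar) \<le> M\<^sub>f"
    and M\<^sub>g: "M\<^sub>g > 0" "\<And>s k i. s \<in> space M \<Longrightarrow> k \<ge> 1 \<Longrightarrow> i \<in> {1..N k s} \<Longrightarrow> norm (d k i s) \<le> M\<^sub>g"
    and q: "q = \<beta> * (2 - \<beta>) / (c * M\<^sub>g\<^sup>2)"
begin

abbreviation S :: "nat \<Rightarrow> nat \<Rightarrow> 's measure" where
  "S \<equiv> stage_algebra M (x 0) N w"

abbreviation D :: "'a \<Rightarrow> real" where
  "D u \<equiv> infdist u (X \<inter> Y)"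

section \<open>The feasible set and the distance to it\<close>

lemma xstar: "xstar \<in> X" "xstar \<in> Y" "\<And>i. i \<in> {1..m} \<Longrightarrow> g i xstar \<le> 0"
  using solution by (auto simp: is_arg_min_def X_def feasible_set_def)

lemma continuous_f: "continuous_on UNIV f"
  using f_convex by (intro convex_on_continuous) auto

lemma continuous_g: "i \<in> {1..m} \<Longrightarrow> continuous_on UNIV (g i)"
  using g_convex by (intro convex_on_continuous) auto

lemma closed_XY: "closed (X \<inter> Y)"
proof -
  have "closed X"
    unfolding X_def feasible_set_def
    by (intro closed_INT ballI closed_Collect_le continuous_g) auto
  then show ?thesis using Y by (intro closed_Int)
qed

lemma convex_XY: "convex (X \<inter> Y)"
proof -
  have "convex {u. g i u \<le> 0}" if "i \<in> {1..m}" for i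
  proof (rule convexI)
    fix u y and a b :: real
    assume *: "u \<in> {u. g i u \<le> 0}" "y \<in> {u. g i u \<le> 0}" "0 \<le> a" "0 \<le> b" "a + b = 1"
    then have "g i (a *\<^sub>R u + b *\<^sub>R y) \<le> a * g i u + b * g i y"
      using g_convex[OF that] by (auto simp: convex_on_def)
    also have "\<dots> \<le> 0" using * by (auto intro!: add_nonpos_nonpos mult_nonneg_nonpos)
    finally show "a *\<^sub>R u + b *\<^sub>R y \<in> {u. g i u \<le> 0}" by simp
  qed
  then have "convex X"
    unfolding X_def feasible_set_def by (intro convex_INT)
  then show ?thesis using Y by (intro convex_Int)
qed

lemma D_attained: obtains y where "y \<in> X \<inter> Y" "D u = norm (u - y)"
  using infdist_attains_inf[OF closed_XY, of u] xstar by (auto simp: dist_norm)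

lemma D_le: "D u \<le> norm (u - xstar)"
  using infdist_le[of xstar "X \<inter> Y" u] xstar by (simp add: dist_norm)

text \<open>Linearising at \<open>xstar\<close> rather than at the projection of \<open>u\<close> keeps the gradient bounded.\<close>

lemma f_ge_linear: "u \<in> Y \<Longrightarrow> gradf xstar \<bullet> (u - xstar) \<le> f u - f xstar"
  using strongly_convex(2)[OF xstar(2), of u] strongly_convex(1)
  by (smt (verit) mult_nonneg_nonneg zero_le_power2 divide_nonneg_nonneg)

text \<open>The vector \<open>u - xstar\<close> is split at a nearest feasible point
  \<open>y\<close>: optimality of \<open>xstar\<close> handles \<open>y - xstar\<close>, and
  Cauchy-Schwarz handles \<open>u - y\<close>.\<close>

lemma linear_ge_D: "- M\<^sub>f * D u \<le> gradf xstar \<bullet> (u - xstar)"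
proof -
  obtain y where y: "y \<in> X \<inter> Y" "D u = norm (u - y)" by (rule D_attained)
  have "0 \<le> gradf xstar \<bullet> (y - xstar)"
    by (rule is_arg_min_GDERIV_nonneg[OF convex_XY solution f_grad y(1)])
  moreover have "\<bar>gradf xstar \<bullet> (u - y)\<bar> \<le> M\<^sub>f * D u"
    unfolding y(2) using Cauchy_Schwarz_ineq2[of "gradf xstar" "u - y"] M\<^sub>f
    by (meson mult_right_mono norm_ge_zero order_trans)
  ultimately show ?thesis
    by (simp add: inner_diff_right)
qed

section \<open>Inequalities along one realisation\<close>

context
  fixes s
  assumes s: "s \<in> space M"
begin

lemma w_in: "1 \<le> k \<Longrightarrow> 1 \<le> i \<Longrightarrow> w k i s \<in> {1..m}"
  using sampling s unfolding sampling_scheme_def p_pos by blast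

lemma v_Suc: "v (Suc k) s = closest_point Y (x k s - \<alpha> *\<^sub>R gradf (x k s))"
  using run[OF s] by (auto simp: gradient_feasibility_run_def)

lemma v_in_Y: "1 \<le> k \<Longrightarrow> v k s \<in> Y"
  using v_Suc[of "k - 1"] Y xstar by (auto intro: closest_point_in_set)

lemma x_eq: "1 \<le> k \<Longrightarrow> x k s = z k (N k s) s"
  using run[OF s] by (cases k) (auto simp: gradient_feasibility_run_def)

lemma z_0: "1 \<le> k \<Longrightarrow> z k 0 s = v k s"
  using run[OF s] by (cases k) (auto simp: gradient_feasibility_run_def feasibility_run_def)

lemma z_Suc:
  assumes "1 \<le> k" "i < N k s"
  shows "d k (Suc i) s \<in> subdifferential (pos_part (g (w k (Suc i) s))) (z k i s)"
    and "z k (Suc i) s = closest_point Y (z k i s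
      - (\<beta> * (pos_part (g (w k (Suc i) s)) (z k i s) / (norm (d k (Suc i) s))\<^sup>2)) *\<^sub>R d k (Suc i) s)"
proof -
  obtain l where l: "k = Suc l" using assms(1) by (cases k) auto
  have "feasibility_run Y g \<beta> (v k s) (N k s) (\<lambda>i. w k i s) (\<lambda>i. d k i s) (\<lambda>i. z k i s)"
    using run[OF s] unfolding gradient_feasibility_run_def l by blast
  then show "d k (Suc i) s \<in> subdifferential (pos_part (g (w k (Suc i) s))) (z k i s)"
    and "z k (Suc i) s = closest_point Y (z k i s
      - (\<beta> * (pos_part (g (w k (Suc i) s)) (z k i s) / (norm (d k (Suc i) s))\<^sup>2)) *\<^sub>R d k (Suc i) s)"
    using assms(2) unfolding feasibility_run_def by (auto dest!: bspec[of _ _ "Suc i"])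
qed

lemma z_in_Y: "1 \<le> k \<Longrightarrow> i \<le> N k s \<Longrightarrow> z k i s \<in> Y"
  using z_0[of k] v_in_Y[of k] z_Suc(2)[of k "i - 1"] Y xstar
  by (cases i) (auto intro!: closest_point_in_set)

lemma x_in_Y: "x k s \<in> Y"
proof (cases "k = 0")
  case True
  then show ?thesis using run[OF s] by (simp add: gradient_feasibility_run_def)
next
  case False
  then show ?thesis using x_eq[of k] z_in_Y[of k "N k s"] by simp
qed

lemma norm_z_Suc_le:
  assumes k: "1 \<le> k" "i < N k s" and y: "y \<in> X \<inter> Y"
  shows "(norm (z k (Suc i) s - y))\<^sup>2 \<le> (norm (z k i s - y))\<^sup>2
    - \<beta> * (2 - \<beta>) / M\<^sub>g\<^sup>2 * (pos_part (g (w k (Suc i) s)) (z k i s))\<^sup>2"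
  unfolding z_Suc(2)[OF k]
proof (rule norm_feasibility_step_le)
  show "g (w k (Suc i) s) y \<le> 0"
    using y w_in[of k "Suc i"] k by (auto simp: X_def feasible_set_def)
  show "norm (d k (Suc i) s) \<le> M\<^sub>g"
    using M\<^sub>g(2)[OF s k(1), of "Suc i"] k(2) by auto
qed (use Y y z_Suc(1)[OF k] step_sizes in auto)

lemma norm_z_le:
  assumes k: "1 \<le> k" and i: "i \<le> N k s"
  shows "norm (z k i s - xstar) \<le> norm (v k s - xstar)"
  using i
proof (induction i)
  case (Suc i)
  have "0 \<le> \<beta> * (2 - \<beta>) / M\<^sub>g\<^sup>2 * (pos_part (g (w k (Suc i) s)) (z k i s))\<^sup>2"
    using step_sizes by simp
  then have "(norm (z k (Suc i) s - xstar))\<^sup>2 \<le> (norm (z k i s - xstar))\<^sup>2"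
    using norm_z_Suc_le[OF k Suc_le_lessD[OF Suc.prems] IntI[OF xstar(1,2)]] by linarith
  then have "norm (z k (Suc i) s - xstar) \<le> norm (z k i s - xstar)"
    by (rule power2_le_imp_le) simp
  then show ?case
    using Suc by simp
qed (use z_0 k in simp)

text \<open>The step inequality is applied to the feasible point nearest to \<open>z k i\<close>;
  its distance to the next iterate bounds \<open>D\<close> there.\<close>

lemma D_z_Suc_le:
  assumes k: "1 \<le> k" "i < N k s"
  shows "(D (z k (Suc i) s))\<^sup>2
    \<le> (D (z k i s))\<^sup>2 - \<beta> * (2 - \<beta>) / M\<^sub>g\<^sup>2 * (pos_part (g (w k (Suc i) s)) (z k i s))\<^sup>2"
proof -
  obtain y where y: "y \<in> X \<inter> Y" "D (z k i s) = norm (z k i s - y)" by (rule D_attained)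
  have "(D (z k (Suc i) s))\<^sup>2 \<le> (norm (z k (Suc i) s - y))\<^sup>2"
    using infdist_le[OF y(1), of "z k (Suc i) s"] by (intro power_mono) (auto simp: dist_norm infdist_nonneg)
  then show ?thesis
    using norm_z_Suc_le[OF k y(1)] y(2) by simp
qed

lemma v_descent:
  "(norm (v (Suc k) s - xstar))\<^sup>2 + 2 * \<alpha> * (f (v (Suc k) s) - f xstar)
    \<le> (1 - \<alpha> * \<mu>) * (norm (x k s - xstar))\<^sup>2"
proof (rule projected_gradient_step[OF Y x_in_Y xstar(2) smooth(2) strongly_convex(2) step_sizes(1) _ v_Suc])
  show "\<alpha> * L \<le> 1" using step_sizes smooth(1) by (simp add: pos_le_divide_eq)
qed

text \<open>Places \<open>1 - \<alpha> * \<mu>\<close> in the interval from 0 (included) to 1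
  (excluded), as needed for a contraction factor and for geometric weights.\<close>

lemma alpha_mu: "0 < \<alpha> * \<mu>" "\<alpha> * \<mu> \<le> 1"
proof -
  show "0 < \<alpha> * \<mu>" using step_sizes strongly_convex by simp
  have "\<alpha> * \<mu> \<le> \<alpha> * L" using mu_le_L step_sizes by (intro mult_left_mono) auto
  also have "\<dots> \<le> 1" using step_sizes smooth(1) by (simp add: pos_le_divide_eq)
  finally show "\<alpha> * \<mu> \<le> 1" .
qed

lemma norm_x_le_v: "1 \<le> k \<Longrightarrow> norm (x k s - xstar) \<le> norm (v k s - xstar)"
  using x_eq[of k] norm_z_le[of k "N k s"] by simp

text \<open>Either \<open>v (Suc k)\<close> lies in the level set of \<open>xstar\<close>, where
  \<open>R\<close> is a bound by assumption, or its objective gap is positive and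
  \<open>v_descent\<close> shows that the gradient step brings the iterate no farther from
  \<open>xstar\<close>. The feasibility steps never increase this distance.\<close>

lemma norm_x_le: "norm (x k s - xstar) \<le> R"
  and norm_v_le: "norm (v (Suc k) s - xstar) \<le> R"
proof -
  have v: "norm (v (Suc k) s - xstar) \<le> R" if x: "norm (x k s - xstar) \<le> R" for k
  proof (cases "f (v (Suc k) s) \<le> f xstar")
    case False
    then have "0 \<le> 2 * \<alpha> * (f (v (Suc k) s) - f xstar)" using step_sizes(1) by simp
    then have "(norm (v (Suc k) s - xstar))\<^sup>2 \<le> (1 - \<alpha> * \<mu>) * (norm (x k s - xstar))\<^sup>2"
      using v_descent[of k] by simp
    also have "\<dots> \<le> 1 * (norm (x k s - xstar))\<^sup>2"
      using alpha_mu by (intro mult_right_mono) auto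
    finally have "(norm (v (Suc k) s - xstar))\<^sup>2 \<le> (norm (x k s - xstar))\<^sup>2"
      by (simp only: mult_1)
    then have "norm (v (Suc k) s - xstar) \<le> norm (x k s - xstar)"
      by (rule power2_le_imp_le) simp
    then show ?thesis using x by simp
  qed (rule R(3))
  show x: "norm (x k s - xstar) \<le> R" for k
  proof (induction k)
    case (Suc k)
    then show ?case using v[of k] norm_x_le_v[of "Suc k"] by simp
  qed (use R(2) s in simp)
  show "norm (v (Suc k) s - xstar) \<le> R" using v x by blast
qed

text \<open>Passing from \<open>k\<close> to \<open>k + 1\<close> multiplies the whole left-hand
  side by \<open>1 - \<alpha> * \<mu>\<close> and adds the new gap. The squared distance is kept on
  the left because the next descent inequality consumes it. For \<open>k = 0\<close> the sum is
  empty, since the gap of \<open>v 1\<close> is not counted.\<close>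

lemma v_weighted_sum_le:
  "(\<Sum>t=2..k+1. (1 - \<alpha> * \<mu>) ^ (k + 1 - t) * (2 * \<alpha> * (f (v t s) - f xstar)))
      + (norm (v (k + 1) s - xstar))\<^sup>2 \<le> (1 - \<alpha> * \<mu>) ^ k * (norm (v 1 s - xstar))\<^sup>2"
proof (induction k)
  case (Suc k)
  let ?a = "1 - \<alpha> * \<mu>" and ?e = "\<lambda>t. 2 * \<alpha> * (f (v t s) - f xstar)"
  have "(norm (v (k + 2) s - xstar))\<^sup>2 + ?e (k + 2) \<le> ?a * (norm (x (k + 1) s - xstar))\<^sup>2"
    using v_descent[of "k + 1"] by simp
  also have "\<dots> \<le> ?a * (norm (v (k + 1) s - xstar))\<^sup>2"
    using norm_x_le_v[of "k + 1"] alpha_mu by (intro mult_left_mono power_mono) auto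
  finally have step: "(norm (v (k + 2) s - xstar))\<^sup>2 + ?e (k + 2) \<le> ?a * (norm (v (k + 1) s - xstar))\<^sup>2" .
  have "(\<Sum>t=2..k+2. ?a ^ (k + 2 - t) * ?e t) = (\<Sum>t=2..k+1. ?a ^ (k + 2 - t) * ?e t) + ?e (k + 2)"
    by simp
  also have "(\<Sum>t=2..k+1. ?a ^ (k + 2 - t) * ?e t) = ?a * (\<Sum>t=2..k+1. ?a ^ (k + 1 - t) * ?e t)"
    unfolding sum_distrib_left by (intro sum.cong) (auto simp: Suc_diff_le)
  finally have "(\<Sum>t=2..k+2. ?a ^ (k + 2 - t) * ?e t) + (norm (v (k + 2) s - xstar))\<^sup>2
    \<le> ?a * ((\<Sum>t=2..k+1. ?a ^ (k + 1 - t) * ?e t) + (norm (v (k + 1) s - xstar))\<^sup>2)"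
    using step by (simp add: algebra_simps)
  also have "\<dots> \<le> ?a * (?a ^ k * (norm (v 1 s - xstar))\<^sup>2)"
    using Suc.IH alpha_mu by (intro mult_left_mono) auto
  finally show ?case by simp
qed simp

lemma v_average_bound:
  assumes "1 \<le> k"
  shows "f ((\<alpha> * \<mu> / (1 - (1 - \<alpha> * \<mu>) ^ k)) *\<^sub>R
      (\<Sum>t=2..k+1. (1 - \<alpha> * \<mu>) ^ (k + 1 - t) *\<^sub>R v t s)) - f xstar
    \<le> \<mu> * (1 - \<alpha> * \<mu>) ^ k * ((norm (v 1 s - xstar))\<^sup>2 / (2 * (1 - (1 - \<alpha> * \<mu>) ^ k)))"
proof -
  let ?a = "1 - \<alpha> * \<mu>"
  define K where "K = \<alpha> * \<mu> / (1 - ?a ^ k)"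
  have "?a ^ k \<le> ?a ^ 1" using alpha_mu assms by (intro power_decreasing) auto
  then have ak: "?a ^ k < 1" using alpha_mu by simp
  have K: "0 < K" using alpha_mu ak by (simp add: K_def)
  have sum1: "(\<Sum>t=2..k+1. K * ?a ^ (k + 1 - t)) = 1"
    unfolding sum_distrib_left[symmetric] using assms alpha_mu ak
    by (subst sum_power_diff) (auto simp: K_def)
  have "f (K *\<^sub>R (\<Sum>t=2..k+1. ?a ^ (k + 1 - t) *\<^sub>R v t s))
      = f (\<Sum>t=2..k+1. (K * ?a ^ (k + 1 - t)) *\<^sub>R v t s)"
    by (simp only: scaleR_sum_right scaleR_scaleR)
  \<comment> \<open>Jensen's inequality for the convex combination.\<close>
  also have "\<dots> \<le> (\<Sum>t=2..k+1. (K * ?a ^ (k + 1 - t)) * f (v t s))"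
    using assms K alpha_mu by (intro convex_on_sum[OF _ _ f_convex sum1]) auto
  finally have "f (K *\<^sub>R (\<Sum>t=2..k+1. ?a ^ (k + 1 - t) *\<^sub>R v t s)) - f xstar
      \<le> (\<Sum>t=2..k+1. (K * ?a ^ (k + 1 - t)) * f (v t s)) - (\<Sum>t=2..k+1. K * ?a ^ (k + 1 - t)) * f xstar"
    unfolding sum1 mult_1 by (rule diff_right_mono)
  also have "\<dots> = K / (2 * \<alpha>) * (\<Sum>t=2..k+1. ?a ^ (k + 1 - t) * (2 * \<alpha> * (f (v t s) - f xstar)))"
    unfolding sum_distrib_left sum_distrib_right sum_subtractf[symmetric]
    using step_sizes by (intro sum.cong) (auto simp: field_simps)
  also have "\<dots> \<le> K / (2 * \<alpha>) * (?a ^ k * (norm (v 1 s - xstar))\<^sup>2)"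
  proof (rule mult_left_mono)
    show "(\<Sum>t=2..k+1. ?a ^ (k + 1 - t) * (2 * \<alpha> * (f (v t s) - f xstar)))
        \<le> ?a ^ k * (norm (v 1 s - xstar))\<^sup>2"
      using v_weighted_sum_le[of k] zero_le_power2[of "norm (v (k + 1) s - xstar)"] by linarith
  qed (use K step_sizes in simp)
  also have "\<dots> = \<mu> * ?a ^ k * ((norm (v 1 s - xstar))\<^sup>2 / (2 * (1 - ?a ^ k)))"
    using step_sizes ak by (simp add: K_def field_simps)
  finally show ?thesis unfolding K_def .
qed

end

section \<open>Expected distance to the feasible set\<close>

lemma space_S [simp]: "space (S k i) = space M"
  by (simp add: stage_algebra_def space_measure_of_conv)

lemma sets_S:
  "sets (S k i) = sigma_sets (space M)
     (history_events M (x 0) N w (k - 1) \<union> {{s \<in> space M. N k s = n} | n. True} \<union>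
      {{s \<in> space M. l \<le> N k s \<and> w k l s = j} | l j. l \<in> {1..i}})"
  unfolding stage_algebra_def by (rule sets_measure_of) (auto simp: history_events_def)

lemma N_measurable: "1 \<le> k \<Longrightarrow> N k \<in> measurable M (count_space UNIV)"
  and w_measurable: "1 \<le> k \<Longrightarrow> 1 \<le> i \<Longrightarrow> w k i \<in> measurable M (count_space UNIV)"
  and x_0_measurable: "x 0 \<in> borel_measurable M"
  using sampling unfolding sampling_scheme_def by blast+

lemma d_measurable_S:
  "1 \<le> k \<Longrightarrow> 1 \<le> i \<Longrightarrow> (\<lambda>s. if i \<le> N k s then d k i s else 0) \<in> borel_measurable (S k i)"
  using sampling unfolding sampling_scheme_def by blast

lemma w_indep_S:
  "1 \<le> k \<Longrightarrow> 1 \<le> i \<Longrightarrow> indep_set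
    (sets (vimage_algebra (space M) (w k i) (count_space UNIV))) (sets (S k (i - 1)))"
  using sampling unfolding sampling_scheme_def by blast

lemma subalgebra_S: assumes "1 \<le> k" shows "subalgebra M (S k i)"
proof -
  have N: "{s \<in> space M. N t s = n} \<in> sets M" if "1 \<le> t" for t n
    using N_measurable[OF that] by measurable
  have w: "{s \<in> space M. l \<le> N t s \<and> w t l s = j} \<in> sets M" if "1 \<le> t" "1 \<le> l" for t l j
    using N_measurable[OF that(1)] w_measurable[OF that] by measurable
  have "sigma_sets (space M)
     (history_events M (x 0) N w (k - 1) \<union> {{s \<in> space M. N k s = n} | n. True} \<union>
      {{s \<in> space M. l \<le> N k s \<and> w k l s = j} | l j. l \<in> {1..i}}) \<subseteq> sets M"
    using N w assms x_0_measurable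
    by (intro sets.sigma_sets_subset) (auto simp: history_events_def intro: measurable_sets)
  then show ?thesis by (simp add: subalgebra_def sets_S)
qed

lemma subalgebra_S_mono:
  assumes "i \<le> j"
  shows "subalgebra (S k j) (S k i)"
proof -
  have "{1..i} \<subseteq> {1..j}" using assms by auto
  then have "{{s \<in> space M. l \<le> N k s \<and> w k l s = n} | l n. l \<in> {1..i}}
      \<subseteq> {{s \<in> space M. l \<le> N k s \<and> w k l s = n} | l n. l \<in> {1..j}}"
    by blast
  then have "sets (S k i) \<subseteq> sets (S k j)"
    unfolding sets_S by (intro sigma_sets_mono' Un_mono order_refl)
  then show ?thesis by (simp add: subalgebra_def)
qed

text \<open>Every generator of a stage of iteration \<open>k\<close> is a generator of the history
  up to \<open>k\<close>, which all stages of iteration \<open>k + 1\<close> contain.\<close>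

lemma subalgebra_S_Suc:
  assumes "1 \<le> k"
  shows "subalgebra (S (Suc k) j) (S k i)"
proof -
  let ?h = "history_events M (x 0) N w"
  have k: "{1..k - 1} \<subseteq> {1..k}" "k \<in> {1..k}" "\<And>l. l \<in> {1..i} \<Longrightarrow> 1 \<le> l"
    using assms by auto
  have "?h (k - 1) \<subseteq> ?h k"
    unfolding history_events_def by (intro Un_mono order_refl) (use k(1) in blast)+
  moreover have "{{s \<in> space M. N k s = n} | n. True} \<subseteq> ?h k"
    unfolding history_events_def using k(2) by blast
  moreover have "{{s \<in> space M. l \<le> N k s \<and> w k l s = n} | l n. l \<in> {1..i}} \<subseteq> ?h k"
  proof
    fix E assume "E \<in> {{s \<in> space M. l \<le> N k s \<and> w k l s = n} | l n. l \<in> {1..i}}"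
    then obtain l n where "E = {s \<in> space M. l \<le> N k s \<and> w k l s = n}" "1 \<le> l"
      using k(3) by blast
    then show "E \<in> ?h k"
      unfolding history_events_def using k(2) by (intro UnI2 CollectI exI[of _ k] exI[of _ l] exI[of _ n]) blast
  qed
  ultimately have "?h (k - 1) \<union> {{s \<in> space M. N k s = n} | n. True} \<union>
      {{s \<in> space M. l \<le> N k s \<and> w k l s = n} | l n. l \<in> {1..i}} \<subseteq> ?h (Suc k - 1)"
    by simp
  then have "sets (S k i) \<subseteq> sets (S (Suc k) j)"
    unfolding sets_S by (intro sigma_sets_mono' le_supI1)
  then show ?thesis by (simp add: subalgebra_def)
qed

lemma N_measurable_S: "N k \<in> measurable (S k i) (count_space UNIV)"
  by (subst measurable_count_space_eq2_countable)
    (auto simp: sets_S vimage_def Int_def conj_commute intro!: sigma_sets.Basic)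

text \<open>The stage sees an index only where it is drawn. The default 0 makes the function total,
  and the event of not being drawn, which joins the preimage of 0, is decided by
  \<open>N k\<close>.\<close>

lemma w_measurable_S:
  assumes "1 \<le> l" "l \<le> i"
  shows "(\<lambda>s. if l \<le> N k s then w k l s else 0) \<in> measurable (S k i) (count_space UNIV)"
proof (subst measurable_count_space_eq2_countable, safe)
  fix j
  have "{s \<in> space M. l \<le> N k s \<and> w k l s = j} \<in> sets (S k i)"
    using assms unfolding sets_S by (intro sigma_sets.Basic) auto
  moreover have "{s \<in> space (S k i). \<not> l \<le> N k s} \<in> sets (S k i)"
    using N_measurable_S[of k i] by measurable
  ultimately have "{s \<in> space M. l \<le> N k s \<and> w k l s = j} \<union> {s \<in> space M. \<not> l \<le> N k s \<and> j = 0}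
      \<in> sets (S k i)"
    by (cases "j = 0") auto
  also have "{s \<in> space M. l \<le> N k s \<and> w k l s = j} \<union> {s \<in> space M. \<not> l \<le> N k s \<and> j = 0}
      = (\<lambda>s. if l \<le> N k s then w k l s else 0) -` {j} \<inter> space (S k i)"
    by (auto split: if_splits)
  finally show "(\<lambda>s. if l \<le> N k s then w k l s else 0) -` {j} \<inter> space (S k i) \<in> sets (S k i)" .
qed auto

text \<open>\<open>z k i\<close> is unconstrained beyond \<open>N k\<close>, hence possibly not measurable there.\<close>

definition Z :: "nat \<Rightarrow> nat \<Rightarrow> 's \<Rightarrow> 'a" where
  "Z k i s = (if i \<le> N k s then z k i s else xstar)"

lemma closest_point_measurable: "closest_point Y \<in> borel_measurable borel"
  using Y xstar by (intro borel_measurable_continuous_onI continuous_on_closest_point) auto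

lemma continuous_pos_part: "i \<in> {1..m} \<Longrightarrow> continuous_on UNIV (pos_part (g i))"
  unfolding pos_part_def[abs_def] by (intro continuous_intros continuous_g)

text \<open>Induction over the inner steps: on the whole space \<open>Z k (Suc i)\<close> is a Borel
  function of \<open>Z k i\<close>, the sample size, the drawn index and the subgradient, all known
  at stage \<open>Suc i\<close>. The index takes countably many values, so measurability for each
  fixed index suffices.\<close>

lemma Z_measurable_S:
  assumes k: "1 \<le> k" and v: "v k \<in> borel_measurable (S k 0)"
  shows "Z k i \<in> borel_measurable (S k i)"
proof (induction i)
  case 0
  have "Z k 0 s = v k s" if "s \<in> space (S k 0)" for s
    using that k by (simp add: Z_def z_0)
  then show ?case using v measurable_cong[of "S k 0" "Z k 0" "v k" borel] by blast
next
  case (Suc i)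
  \<comment> \<open>The constraint functions are known to be continuous only for indices in
    \<open>{1..m}\<close>; setting the others to 0 makes \<open>G j\<close> measurable for every
    \<open>j\<close>, including the default index 0.\<close>
  define G where "G j = (if j \<in> {1..m} then pos_part (g j) else (\<lambda>_. 0))" for j
  define d' where "d' s = (if Suc i \<le> N k s then d k (Suc i) s else 0)" for s
  define w' where "w' s = (if Suc i \<le> N k s then w k (Suc i) s else 0)" for s
  have G: "G j \<in> borel_measurable borel" for j
    using continuous_pos_part by (auto simp: G_def intro: borel_measurable_continuous_onI)
  have [measurable]: "Z k i \<in> borel_measurable (S k (Suc i))"
    by (rule measurable_from_subalg[OF subalgebra_S_mono Suc.IH]) simp
  have [measurable]: "d' \<in> borel_measurable (S k (Suc i))"
    using d_measurable_S[OF k, of "Suc i"] by (simp add: d'_def[abs_def])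
  have "w' \<in> measurable (S k (Suc i)) (count_space UNIV)"
    unfolding w'_def by (rule w_measurable_S) auto
  then have [measurable]: "(\<lambda>s. G (w' s) (Z k i s)) \<in> borel_measurable (S k (Suc i))"
    by (rule measurable_compose_countable[rotated]) (use G in measurable)
  note [measurable] = closest_point_measurable N_measurable_S[of k "Suc i"]
  define z' where "z' s = (if Suc i \<le> N k s then closest_point Y
      (Z k i s - (\<beta> * (G (w' s) (Z k i s) / (norm (d' s))\<^sup>2)) *\<^sub>R d' s) else xstar)" for s
  have "z' \<in> borel_measurable (S k (Suc i))"
    unfolding z'_def[abs_def] by measurable
  moreover have "Z k (Suc i) s = z' s" if s: "s \<in> space (S k (Suc i))" for s
    using z_Suc(2)[of s k i] w_in[of s k "Suc i"] s k by (auto simp: Z_def G_def d'_def w'_def z'_def)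
  ultimately show ?case using measurable_cong[of "S k (Suc i)" "Z k (Suc i)" z' borel] by blast
qed

text \<open>Induction over the outer iterations. The output sits at the random position
  \<open>N k\<close>, so it is composed from the countably many functions \<open>Z k i\<close>; the
  gradient step preserves measurability because gradient and projection are Borel.\<close>

lemma x_measurable_S: "x k \<in> borel_measurable (S (Suc k) 0)"
  and v_measurable_S: "v (Suc k) \<in> borel_measurable (S (Suc k) 0)"
proof -
  have v: "v (Suc k) \<in> borel_measurable (S (Suc k) 0)" if x: "x k \<in> borel_measurable (S (Suc k) 0)" for k
  proof -
    note [measurable] = x closest_point_measurable borel_measurable_GDERIV[OF f_grad]
    have "(\<lambda>s. closest_point Y (x k s - \<alpha> *\<^sub>R gradf (x k s))) \<in> borel_measurable (S (Suc k) 0)"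
      by measurable
    then show ?thesis
      by (subst measurable_cong[OF v_Suc]) auto
  qed
  show x: "x k \<in> borel_measurable (S (Suc k) 0)" for k
  proof (induction k)
    case 0
    show ?case
    proof (rule measurableI)
      fix A :: "'a set" assume "A \<in> sets borel"
      then show "x 0 -` A \<inter> space (S (Suc 0) 0) \<in> sets (S (Suc 0) 0)"
        by (auto simp: sets_S history_events_def intro!: sigma_sets.Basic)
    qed auto
  next
    case (Suc k)
    have "Z (Suc k) i \<in> borel_measurable (S (Suc (Suc k)) 0)" for i
      by (rule measurable_from_subalg[OF subalgebra_S_Suc Z_measurable_S[OF _ v[OF Suc.IH]]]) auto
    moreover have "N (Suc k) \<in> measurable (S (Suc (Suc k)) 0) (count_space UNIV)"
      by (rule measurable_from_subalg[OF subalgebra_S_Suc N_measurable_S]) simp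
    ultimately have "(\<lambda>s. Z (Suc k) (N (Suc k) s) s) \<in> borel_measurable (S (Suc (Suc k)) 0)"
      by (rule measurable_compose_countable)
    moreover have "x (Suc k) s = Z (Suc k) (N (Suc k) s) s" if "s \<in> space (S (Suc (Suc k)) 0)" for s
      using that by (simp add: x_eq Z_def)
    ultimately show ?case
      by (subst measurable_cong) auto
  qed
  show "v (Suc k) \<in> borel_measurable (S (Suc k) 0)" using v x by blast
qed

lemma x_measurable: "x k \<in> borel_measurable M"
  by (rule measurable_from_subalg[OF subalgebra_S x_measurable_S]) simp

lemma Z_measurable: "1 \<le> k \<Longrightarrow> Z k i \<in> borel_measurable (S k i)"
  using Z_measurable_S[of k i] v_measurable_S[of "k - 1"] by simp

lemma norm_Z_le: assumes "1 \<le> k" "s \<in> space M" shows "norm (Z k i s - xstar) \<le> R"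
proof (cases "i \<le> N k s")
  case True
  then show ?thesis
    using norm_z_le[OF assms(2,1) True] norm_v_le[OF assms(2), of "k - 1"] assms(1) by (simp add: Z_def)
qed (use R in \<open>simp add: Z_def\<close>)

lemma integrable_Z:
  assumes k: "1 \<le> k" and h: "continuous_on UNIV h" and A: "A \<in> sets M"
  shows "integrable M (\<lambda>s. indicator A s * (h (Z k i s) :: real))"
proof -
  have "Z k i \<in> borel_measurable M"
    using subalgebra_S[OF k] Z_measurable[OF k] by (rule measurable_from_subalg)
  then have "integrable M (\<lambda>s. h (Z k i s))"
    using h norm_Z_le[OF k] by (intro integrable_continuous_of_bounded) auto
  from integrable_mult_indicator[OF A this] show ?thesis by simp
qed

lemma integrable_x:
  fixes h :: "'a \<Rightarrow> real"
  shows "continuous_on UNIV h \<Longrightarrow> integrable M (\<lambda>s. h (x k s))"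
  using x_measurable norm_x_le by (intro integrable_continuous_of_bounded) auto

lemma continuous_D: "continuous_on UNIV D"
  by (intro continuous_intros)

lemma continuous_D2: "continuous_on UNIV (\<lambda>u. (D u)\<^sup>2)"
  by (intro continuous_intros)

section \<open>Contraction of the expected squared distance\<close>

lemma prob_w:
  assumes "1 \<le> k" "1 \<le> i"
  shows "prob {s \<in> space M. w k i s = j} = pmf p j"
proof -
  have "distr M (count_space UNIV) (w k i) = measure_pmf p"
    using sampling assms by (auto simp: sampling_scheme_def)
  then have "pmf p j = measure (distr M (count_space UNIV) (w k i)) {j}"
    by (simp add: measure_pmf_single)
  also have "\<dots> = prob (w k i -` {j} \<inter> space M)"
    using w_measurable[OF assms] by (rule measure_distr) simp
  finally show ?thesis by (simp add: vimage_def Int_def conj_commute)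
qed

text \<open>\<open>A\<close> and \<open>Z k i\<close> are known at stage \<open>i\<close>, and the
  next index is independent of that stage, so the expected squared violation is an average over the
  law \<open>p\<close>. The regularity condition bounds this average below by
  \<open>D\<^sup>2 / c\<close>. The truncation at 0 keeps the factor nonnegative, hence iterable,
  also when \<open>q > 1\<close>.\<close>

lemma expectation_D_step:
  assumes k: "1 \<le> k" and A: "A \<in> sets (S k 0)" and i: "\<And>s. s \<in> A \<Longrightarrow> i < N k s"
  shows "expectation (\<lambda>s. indicator A s * (D (Z k (Suc i) s))\<^sup>2)
    \<le> max 0 (1 - q) * expectation (\<lambda>s. indicator A s * (D (Z k i s))\<^sup>2)"
proof -
  \<comment> \<open>The guaranteed decrease of the squared distance per unit of squared violation,
    so that \<open>q\<close> is \<open>\<kappa> / c\<close>.\<close>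
  define \<kappa> where "\<kappa> = \<beta> * (2 - \<beta>) / M\<^sub>g\<^sup>2"
  have \<kappa>: "0 \<le> \<kappa>" "q = \<kappa> / c" using step_sizes by (simp_all add: \<kappa>_def q field_simps)
  define H where "H j s = indicator A s * (pos_part (g j) (Z k i s))\<^sup>2" for j s
  have AM: "A \<in> sets M" using A subalgebra_S[OF k] by (auto simp: subalgebra_def)
  have Ai [measurable]: "A \<in> sets (S k i)"
    using A subalgebra_S_mono[of 0 i k] by (auto simp: subalgebra_def)
  have Asp: "s \<in> space M" if "s \<in> A" for s using sets.sets_into_space[OF AM] that by auto
  note [measurable] = Z_measurable[OF k, of i]
  have Hm: "H j \<in> borel_measurable (S k i)" if "j \<in> {1..m}" for j
  proof -
    note [measurable] = borel_measurable_continuous_onI[OF continuous_pos_part[OF that]]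
    show ?thesis unfolding H_def[abs_def] by measurable
  qed
  have Hi: "integrable M (H j)" if "j \<in> {1..m}" for j
    unfolding H_def[abs_def] using continuous_pos_part[OF that]
    by (intro integrable_Z k AM continuous_intros)
  have "indep_set (sets (vimage_algebra (space M) (w k (Suc i)) (count_space UNIV))) (sets (S k i))"
    using w_indep_S[OF k, of "Suc i"] by simp
  note indep = expectation_indep_index[where H = H, OF subalgebra_S[OF k] w_measurable[OF k] this
    finite_atLeastAtMost w_in[OF _ k] Hm Hi, simplified]
  \<comment> \<open>Regularity holds on \<open>Y\<close> only; on \<open>A\<close> the step is
    really performed, so there \<open>Z k i\<close> is an actual iterate and lies in
    \<open>Y\<close>.\<close>
  have "expectation (\<lambda>s. indicator A s * (D (Z k i s))\<^sup>2 / c)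
      \<le> expectation (\<lambda>s. \<Sum>j\<in>{1..m}. pmf p j * H j s)"
  proof (intro integral_mono Bochner_Integration.integrable_sum integrable_mult_right Hi)
    show "integrable M (\<lambda>s. indicator A s * (D (Z k i s))\<^sup>2 / c)"
      using integrable_Z[OF k continuous_D2 AM] by simp
    fix s assume s: "s \<in> space M"
    show "indicator A s * (D (Z k i s))\<^sup>2 / c \<le> (\<Sum>j\<in>{1..m}. pmf p j * H j s)"
    proof (cases "s \<in> A")
      case True
      then have "Z k i s \<in> Y" using z_in_Y[OF s k, of i] i[OF True] by (simp add: Z_def)
      from c(2)[OF this] have "(D (Z k i s))\<^sup>2 / c \<le> (\<Sum>j\<in>{1..m}. (pos_part (g j) (Z k i s))\<^sup>2 * pmf p j)"
        using c(1) p_pos by (subst (asm) integral_measure_pmf_real[of "{1..m}"])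
          (auto simp: pos_divide_le_eq mult.commute)
      then show ?thesis using True by (simp add: H_def mult.commute)
    qed (simp add: H_def)
  qed auto
  also have "\<dots> = (\<Sum>j\<in>{1..m}. pmf p j * expectation (H j))"
    using Hi by (subst Bochner_Integration.integral_sum) auto
  also have "\<dots> = expectation (\<lambda>s. H (w k (Suc i) s) s)"
    using indep(2) prob_w[OF k, of "Suc i"] by simp
  finally have E: "expectation (\<lambda>s. indicator A s * (D (Z k i s))\<^sup>2) / c
      \<le> expectation (\<lambda>s. H (w k (Suc i) s) s)"
    by simp
  have iD: "integrable M (\<lambda>s. indicator A s * (D (Z k i s))\<^sup>2)" for i
    by (rule integrable_Z[OF k continuous_D2 AM])
  have "expectation (\<lambda>s. indicator A s * (D (Z k (Suc i) s))\<^sup>2)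
      \<le> expectation (\<lambda>s. indicator A s * (D (Z k i s))\<^sup>2 - \<kappa> * H (w k (Suc i) s) s)"
  proof (intro integral_mono iD Bochner_Integration.integrable_diff integrable_mult_right indep(1))
    fix s assume s: "s \<in> space M"
    show "indicator A s * (D (Z k (Suc i) s))\<^sup>2
        \<le> indicator A s * (D (Z k i s))\<^sup>2 - \<kappa> * H (w k (Suc i) s) s"
      using D_z_Suc_le[OF s k, of i] i[of s] by (cases "s \<in> A") (auto simp: Z_def H_def \<kappa>_def)
  qed
  also have "\<dots> = expectation (\<lambda>s. indicator A s * (D (Z k i s))\<^sup>2)
      - \<kappa> * expectation (\<lambda>s. H (w k (Suc i) s) s)"
    using iD indep(1) by (subst Bochner_Integration.integral_diff) auto
  also have "\<dots> \<le> expectation (\<lambda>s. indicator A s * (D (Z k i s))\<^sup>2)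
      - \<kappa> * (expectation (\<lambda>s. indicator A s * (D (Z k i s))\<^sup>2) / c)"
    using mult_left_mono[OF E \<kappa>(1)] by simp
  also have "\<dots> = (1 - q) * expectation (\<lambda>s. indicator A s * (D (Z k i s))\<^sup>2)"
    by (simp add: \<kappa>(2) algebra_simps)
  also have "\<dots> \<le> max 0 (1 - q) * expectation (\<lambda>s. indicator A s * (D (Z k i s))\<^sup>2)"
    by (intro mult_right_mono integral_nonneg_AE) auto
  finally show ?thesis .
qed

text \<open>\<open>A\<close> is decided before the first index is drawn, so the one-step contraction
  applies to the same event at all \<open>i\<close> steps. The start is bounded by the distance to
  \<open>xstar\<close>, which is at most \<open>R\<close>.\<close>

lemma expectation_D_le:
  assumes k: "1 \<le> k" and A: "A \<in> sets (S k 0)" and N: "\<And>s. s \<in> A \<Longrightarrow> i \<le> N k s"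
  shows "expectation (\<lambda>s. indicator A s * (D (Z k i s))\<^sup>2) \<le> max 0 (1 - q) ^ i * (R\<^sup>2 * prob A)"
  using N
proof (induction i)
  case 0
  have AM: "A \<in> sets M" using A subalgebra_S[OF k] by (auto simp: subalgebra_def)
  have "expectation (\<lambda>s. indicator A s * (D (Z k 0 s))\<^sup>2) \<le> expectation (\<lambda>s. indicator A s * R\<^sup>2)"
  proof (intro integral_mono integrable_Z[OF k continuous_D2 AM])
    show "integrable M (\<lambda>s. indicator A s * R\<^sup>2)"
      using AM by (auto simp: emeasure_eq_measure)
    fix s assume "s \<in> space M"
    then have "D (Z k 0 s) \<le> R" using norm_Z_le[OF k, of s 0] D_le[of "Z k 0 s"] by simp
    then show "indicator A s * (D (Z k 0 s))\<^sup>2 \<le> indicator A s * R\<^sup>2"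
      by (intro mult_left_mono power_mono) (auto simp: infdist_nonneg)
  qed
  then show ?case using AM by (simp add: mult.commute)
next
  case (Suc i)
  have "expectation (\<lambda>s. indicator A s * (D (Z k (Suc i) s))\<^sup>2)
      \<le> max 0 (1 - q) * expectation (\<lambda>s. indicator A s * (D (Z k i s))\<^sup>2)"
    using Suc.prems by (intro expectation_D_step[OF k A]) (auto simp: Suc_le_eq)
  also have "\<dots> \<le> max 0 (1 - q) * (max 0 (1 - q) ^ i * (R\<^sup>2 * prob A))"
    using Suc.IH Suc.prems by (intro mult_left_mono) (auto dest: Suc_leD)
  finally show ?case by simp
qed

section \<open>Bounds in conditional and total expectation\<close>

lemma half_pow_nonneg: "0 \<le> half_pow a n"
  by (simp add: half_pow_def)

lemma half_pow_square: "(half_pow a n)\<^sup>2 = max 0 a ^ n"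
proof -
  have "(sqrt (max 0 a) ^ n)\<^sup>2 = ((sqrt (max 0 a))\<^sup>2) ^ n"
    by (simp only: power_mult[symmetric] mult.commute)
  then show ?thesis by (simp add: half_pow_def)
qed

text \<open>On an event where \<open>N k = n\<close> the output is \<open>Z k n\<close>, so the
  contraction can be iterated exactly \<open>n\<close> times. Passing from the squared distance to
  the distance halves the exponent.\<close>

lemma cond_exp_D_le:
  assumes k: "1 \<le> k"
  shows "AE s in M. real_cond_exp M (S k 0) (\<lambda>s. D (x k s)) s \<le> half_pow (1 - q) (N k s) * R"
proof (rule real_cond_exp_le_of_integral_le[OF subalgebra_S[OF k] N_measurable_S
      integrable_x[OF continuous_D], where b = "\<lambda>n. half_pow (1 - q) n * R"])
  fix A n assume A: "A \<in> sets (S k 0)" and n: "\<And>s. s \<in> A \<Longrightarrow> N k s = n"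
  have AM: "A \<in> sets M" using A subalgebra_S[OF k] by (auto simp: subalgebra_def)
  have "expectation (\<lambda>s. indicator A s * D (x k s)) = expectation (\<lambda>s. indicator A s * D (Z k n s))"
    using n x_eq[OF _ k] by (intro Bochner_Integration.integral_cong) (auto simp: Z_def indicator_def)
  also have "\<dots> \<le> half_pow (1 - q) n * R * prob A"
  proof (rule integral_indicator_le_of_square[OF AM integrable_Z[OF k continuous_D AM]
        integrable_Z[OF k continuous_D2 AM]])
    show "0 \<le> half_pow (1 - q) n * R" using R(1) half_pow_nonneg by simp
    show "expectation (\<lambda>s. indicator A s * (D (Z k n s))\<^sup>2) \<le> (half_pow (1 - q) n * R)\<^sup>2 * prob A"
      using expectation_D_le[OF k A, of n] n by (simp add: power_mult_distrib half_pow_square)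
  qed
  finally show "expectation (\<lambda>s. indicator A s * D (x k s)) \<le> half_pow (1 - q) n * R * prob A" .
qed

lemma M\<^sub>f_nonneg: "0 \<le> M\<^sub>f"
  using M\<^sub>f norm_ge_zero order_trans by blast

lemma cond_exp_f_ge:
  assumes k: "1 \<le> k"
  shows "AE s in M. real_cond_exp M (S k 0) (\<lambda>s. f (x k s) - f xstar) s
    \<ge> - M\<^sub>f * half_pow (1 - q) (N k s) * R"
proof -
  interpret F: finite_measure_subalgebra M "S k 0"
    by standard (rule subalgebra_S[OF k])
  have iD: "integrable M (\<lambda>s. D (x k s))" by (rule integrable_x[OF continuous_D])
  have "AE s in M. real_cond_exp M (S k 0) (\<lambda>s. - M\<^sub>f * D (x k s)) s
      \<le> real_cond_exp M (S k 0) (\<lambda>s. f (x k s) - f xstar) s"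
  proof (rule F.real_cond_exp_mono)
    show "AE s in M. - M\<^sub>f * D (x k s) \<le> f (x k s) - f xstar"
      using linear_ge_D f_ge_linear[OF x_in_Y] by (intro AE_I2) (meson order_trans)
    show "integrable M (\<lambda>s. f (x k s) - f xstar)"
      using integrable_x[OF continuous_f] by simp
  qed (use iD in simp)
  moreover have "AE s in M. real_cond_exp M (S k 0) (\<lambda>s. - M\<^sub>f * D (x k s)) s
      = - M\<^sub>f * real_cond_exp M (S k 0) (\<lambda>s. D (x k s)) s"
    by (rule F.real_cond_exp_cmult[OF iD])
  ultimately show ?thesis
    using cond_exp_D_le[OF k]
  proof eventually_elim
    case (elim s)
    have "M\<^sub>f * real_cond_exp M (S k 0) (\<lambda>s. D (x k s)) s \<le> M\<^sub>f * (half_pow (1 - q) (N k s) * R)"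
      using elim(3) M\<^sub>f_nonneg by (rule mult_left_mono)
    then show ?case using elim(1,2) by simp
  qed
qed

lemma half_pow_le_1: "half_pow (1 - q) n \<le> 1"
proof -
  have "0 \<le> q" using q c(1) step_sizes by simp
  then show ?thesis by (simp add: half_pow_def power_le_one)
qed

lemma integrable_half_pow:
  assumes "1 \<le> k"
  shows "integrable M (\<lambda>s. half_pow (1 - q) (N k s))"
proof (rule integrable_const_bound[where B = 1])
  show "(\<lambda>s. half_pow (1 - q) (N k s)) \<in> borel_measurable M"
    using N_measurable[OF assms] by measurable
qed (simp add: half_pow_nonneg half_pow_le_1)

text \<open>The conditional bound is integrated, using that conditional expectation preserves the
  mean.\<close>

lemma expectation_D_x_le:
  assumes k: "1 \<le> k"
  shows "expectation (\<lambda>s. D (x k s)) \<le> expectation (\<lambda>s. half_pow (1 - q) (N k s)) * R"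
proof -
  interpret F: finite_measure_subalgebra M "S k 0"
    by standard (rule subalgebra_S[OF k])
  have iD: "integrable M (\<lambda>s. D (x k s))" by (rule integrable_x[OF continuous_D])
  have "expectation (\<lambda>s. D (x k s)) = expectation (real_cond_exp M (S k 0) (\<lambda>s. D (x k s)))"
    using F.real_cond_exp_int(2)[OF iD] by simp
  also have "\<dots> \<le> expectation (\<lambda>s. half_pow (1 - q) (N k s) * R)"
    using cond_exp_D_le[OF k] F.real_cond_exp_int(1)[OF iD] integrable_half_pow[OF k]
    by (intro integral_mono_AE) auto
  finally show ?thesis by simp
qed

text \<open>The lower bound for \<open>f\<close> at the average is linear in the average, so it
  splits into the weighted linear terms of the single iterates. Each of them is bounded by its
  distance to the feasible set, and the largest expectation serves for all because the weights sum
  to 1.\<close>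

lemma expectation_f_average_ge:
  "expectation (\<lambda>s. f ((\<alpha> * \<mu> / (1 - (1 - \<alpha> * \<mu>) ^ (k + 1))) *\<^sub>R
      (\<Sum>t=1..k+1. (1 - \<alpha> * \<mu>) ^ (k + 1 - t) *\<^sub>R x t s)) - f xstar)
    \<ge> - M\<^sub>f * (MAX t\<in>{1..k+1}. expectation (\<lambda>s. half_pow (1 - q) (N t s))) * R"
proof -
  let ?a = "1 - \<alpha> * \<mu>"
  let ?E = "\<lambda>t. expectation (\<lambda>s. half_pow (1 - q) (N t s))"
  define K where "K = \<alpha> * \<mu> / (1 - ?a ^ (k + 1))"
  define b where "b t = K * ?a ^ (k + 1 - t)" for t
  \<comment> \<open>The bounds \<open>alpha_mu\<close> were derived for a given realisation, so some
    realisation must be supplied.\<close>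
  obtain s\<^sub>0 where s\<^sub>0: "s\<^sub>0 \<in> space M" using not_empty by blast
  note alpha_mu = alpha_mu[OF s\<^sub>0]
  have "?a ^ (k + 1) \<le> ?a ^ 1" using alpha_mu by (intro power_decreasing) auto
  then have ak: "?a ^ (k + 1) < 1" using alpha_mu by simp
  have "0 < K" using alpha_mu ak by (simp add: K_def)
  then have b0: "0 \<le> b t" for t using alpha_mu by (simp add: b_def)
  \<comment> \<open>This average starts at \<open>t = 1\<close>, so the exponents run from
    \<open>k\<close> down to 0 and the normaliser contains the power \<open>k + 1\<close>.\<close>
  have b1: "(\<Sum>t\<in>{1..k+1}. b t) = 1"
    unfolding b_def sum_distrib_left[symmetric] using alpha_mu ak
    by (subst sum_power_diff) (auto simp: K_def)
  define xbar where "xbar s = (\<Sum>t\<in>{1..k+1}. b t *\<^sub>R x t s)" for s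
  have xbar: "K *\<^sub>R (\<Sum>t=1..k+1. ?a ^ (k + 1 - t) *\<^sub>R x t s) = xbar s" for s
    by (simp only: scaleR_sum_right scaleR_scaleR xbar_def b_def)
  have diff: "xbar s - xstar = (\<Sum>t\<in>{1..k+1}. b t *\<^sub>R (x t s - xstar))" for s
    unfolding xbar_def scaleR_diff_right sum_subtractf scaleR_sum_left[symmetric] b1 by (simp only: scaleR_one)
  have xbar_le: "norm (xbar s - xstar) \<le> R" if s: "s \<in> space M" for s
  proof -
    have "norm (xbar s - xstar) \<le> (\<Sum>t\<in>{1..k+1}. norm (b t *\<^sub>R (x t s - xstar)))"
      unfolding diff by (rule norm_sum)
    also have "\<dots> \<le> (\<Sum>t\<in>{1..k+1}. b t * R)"
      using b0 norm_x_le[OF s] by (intro sum_mono) (simp add: mult_left_mono)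
    also have "\<dots> = R" unfolding sum_distrib_right[symmetric] b1 by simp
    finally show ?thesis .
  qed
  have xbar_Y: "xbar s \<in> Y" if s: "s \<in> space M" for s
    unfolding xbar_def using x_in_Y[OF s] b0 by (intro convex_sum[OF _ Y(2) b1]) auto
  have "xbar \<in> borel_measurable M"
    unfolding xbar_def[abs_def] using x_measurable by measurable
  then have int_f: "integrable M (\<lambda>s. f (xbar s) - f xstar)"
    using xbar_le continuous_f
    by (intro Bochner_Integration.integrable_diff integrable_continuous_of_bounded) auto
  have int_D: "integrable M (\<lambda>s. b t * (- M\<^sub>f * D (x t s)))" for t
    using integrable_x[OF continuous_D] by simp
  have "- M\<^sub>f * (MAX t\<in>{1..k+1}. ?E t) * R = (\<Sum>t\<in>{1..k+1}. b t * (- M\<^sub>f * ((MAX t\<in>{1..k+1}. ?E t) * R)))"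
    unfolding sum_distrib_right[symmetric] b1 by simp
  also have "\<dots> \<le> (\<Sum>t\<in>{1..k+1}. b t * (- M\<^sub>f * expectation (\<lambda>s. D (x t s))))"
  proof (rule sum_mono, rule mult_left_mono[OF mult_left_mono_neg b0])
    fix t assume t: "t \<in> {1..k+1}"
    then have "expectation (\<lambda>s. D (x t s)) \<le> ?E t * R"
      by (intro expectation_D_x_le) simp
    also have "\<dots> \<le> (MAX t\<in>{1..k+1}. ?E t) * R"
      using t R(1) by (intro mult_right_mono Max_ge) auto
    finally show "expectation (\<lambda>s. D (x t s)) \<le> (MAX t\<in>{1..k+1}. ?E t) * R" .
  qed (use M\<^sub>f_nonneg in simp)
  also have "\<dots> = expectation (\<lambda>s. \<Sum>t\<in>{1..k+1}. b t * (- M\<^sub>f * D (x t s)))"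
    using int_D by (subst Bochner_Integration.integral_sum) auto
  also have "\<dots> \<le> expectation (\<lambda>s. f (xbar s) - f xstar)"
  proof (intro integral_mono Bochner_Integration.integrable_sum int_D int_f)
    fix s assume s: "s \<in> space M"
    have "(\<Sum>t\<in>{1..k+1}. b t * (- M\<^sub>f * D (x t s))) \<le> (\<Sum>t\<in>{1..k+1}. b t * (gradf xstar \<bullet> (x t s - xstar)))"
      by (intro sum_mono mult_left_mono b0 linear_ge_D)
    also have "\<dots> = gradf xstar \<bullet> (xbar s - xstar)"
      unfolding diff inner_sum_right by simp
    also have "\<dots> \<le> f (xbar s) - f xstar" by (rule f_ge_linear[OF xbar_Y[OF s]])
    finally show "(\<Sum>t\<in>{1..k+1}. b t * (- M\<^sub>f * D (x t s))) \<le> f (xbar s) - f xstar" .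
  qed
  finally show ?thesis unfolding xbar[unfolded K_def] .
qed

end

theorem theoremD3:
  fixes M :: "'s measure"
    and f :: "'a::euclidean_space \<Rightarrow> real" and gradf :: "'a \<Rightarrow> 'a"
    and m :: nat and g :: "nat \<Rightarrow> 'a \<Rightarrow> real"
    and X Y :: "'a set" and xstar :: 'a
    and p :: "nat pmf"
    and c L \<mu> \<alpha> \<beta> M\<^sub>0 B\<^sub>0 M\<^sub>f M\<^sub>g q :: real
    and N :: "nat \<Rightarrow> 's \<Rightarrow> nat"
    and w :: "nat \<Rightarrow> nat \<Rightarrow> 's \<Rightarrow> nat"
    and d z :: "nat \<Rightarrow> nat \<Rightarrow> 's \<Rightarrow> 'a"
    and x v :: "nat \<Rightarrow> 's \<Rightarrow> 'a"
  assumes "prob_space M"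
    and f_convex: "convex_on UNIV f"
    and f_grad: "\<forall>u. GDERIV f u :> gradf u"
    and X_def: "X = feasible_set m g"
    and g_convex: "\<forall>i\<in>{1..m}. convex_on UNIV (g i)"
    and Y: "closed Y" "convex Y"
    and feasible: "X \<inter> Y \<noteq> {}"
    and p_pos: "set_pmf p = {1..m}"
    and c: "c > 0"
      "\<forall>u\<in>Y. (infdist u (X \<inter> Y))\<^sup>2
                \<le> c * measure_pmf.expectation p (\<lambda>j. (pos_part (g j) u)\<^sup>2)"
    and smooth: "L > 0"
      "\<forall>u\<in>Y. \<forall>y\<in>Y. f y - f u \<le> gradf u \<bullet> (y - u) + L / 2 * (norm (y - u))\<^sup>2"
    and strongly_convex: "\<mu> > 0"
      "\<forall>u\<in>Y. \<forall>y\<in>Y. f y - f u \<ge> gradf u \<bullet> (y - u) + \<mu> / 2 * (norm (y - u))\<^sup>2"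
    and mu_le_L: "\<mu> \<le> L"
    and solution: "is_arg_min f (\<lambda>u. u \<in> X \<inter> Y) xstar"
    and step_sizes: "0 < \<alpha>" "\<alpha> \<le> 1 / L" "0 < \<beta>" "\<beta> < 2"
    and sampling: "sampling_scheme M p (x 0) N w d"
    and run: "\<forall>s\<in>space M. gradient_feasibility_run Y g gradf (\<lambda>_. \<alpha>) \<beta>
        (\<lambda>k. N k s) (\<lambda>k i. w k i s) (\<lambda>k i. d k i s)
        (\<lambda>k. x k s) (\<lambda>k. v k s) (\<lambda>k i. z k i s)"
    and M\<^sub>0: "M\<^sub>0 > 0" "\<forall>s\<in>space M. norm (x 0 s) \<le> M\<^sub>0"
    and B\<^sub>0: "B\<^sub>0 \<ge> M\<^sub>0" "\<forall>u. f u \<le> f xstar \<longrightarrow> norm u \<le> B\<^sub>0"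
    and M\<^sub>f: "M\<^sub>f > 0" "\<forall>s\<in>space M. \<forall>k. norm (gradf (x k s)) \<le> M\<^sub>f"
      "norm (gradf xstar) \<le> M\<^sub>f"
    and M\<^sub>g: "M\<^sub>g > 0" "\<forall>s\<in>space M. \<forall>k\<ge>1. \<forall>i\<in>{1..N k s}. norm (d k i s) \<le> M\<^sub>g"
    and q: "q = \<beta> * (2 - \<beta>) / (c * M\<^sub>g\<^sup>2)"
  shows "(\<forall>s\<in>space M. \<forall>k\<ge>1.
            f ((\<alpha> * \<mu> / (1 - (1 - \<alpha> * \<mu>) ^ k)) *\<^sub>R
                 (\<Sum>t=2..k+1. (1 - \<alpha> * \<mu>) ^ (k + 1 - t) *\<^sub>R v t s)) - f xstar
              \<le> \<mu> * (1 - \<alpha> * \<mu>) ^ k * ((norm (v 1 s - xstar))\<^sup>2 / (2 * (1 - (1 - \<alpha> * \<mu>) ^ k))))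
       \<and> (\<forall>k\<ge>1. AE s in M.
            real_cond_exp M (stage_algebra M (x 0) N w k 0) (\<lambda>s. f (x k s) - f xstar) s
              \<ge> - M\<^sub>f * half_pow (1 - q) (N k s) * (B\<^sub>0 + norm xstar))
       \<and> (\<forall>k\<ge>1.
            prob_space.expectation M (\<lambda>s.
              f ((\<alpha> * \<mu> / (1 - (1 - \<alpha> * \<mu>) ^ (k + 1))) *\<^sub>R
                   (\<Sum>t=1..k+1. (1 - \<alpha> * \<mu>) ^ (k + 1 - t) *\<^sub>R x t s)) - f xstar)
              \<ge> - M\<^sub>f * (MAX t\<in>{1..k+1}. prob_space.expectation M (\<lambda>s. half_pow (1 - q) (N t s)))
                    * (B\<^sub>0 + norm xstar))"
proof -
  \<comment> \<open>Turns bounds about the origin into bounds about \<open>xstar\<close>, which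
    gives the radius for which the estimates are instantiated.\<close>
  have R: "norm (u - xstar) \<le> B\<^sub>0 + norm xstar" if "norm u \<le> B\<^sub>0" for u
    using that norm_triangle_ineq4[of u xstar] by linarith
  interpret prob_space M by fact
  interpret randomized_feasibility_gradient M f gradf m g X Y xstar p c L \<mu> \<alpha> \<beta>
    "B\<^sub>0 + norm xstar" M\<^sub>f M\<^sub>g q N w d z x v
  proof unfold_locales
    show "0 < B\<^sub>0 + norm xstar" using M\<^sub>0(1) B\<^sub>0(1) norm_ge_zero[of xstar] by linarith
    show "norm (x 0 s - xstar) \<le> B\<^sub>0 + norm xstar" if "s \<in> space M" for s
      using that M\<^sub>0(2) B\<^sub>0(1) by (intro R) force
    show "norm (u - xstar) \<le> B\<^sub>0 + norm xstar" if "f u \<le> f xstar" for u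
      using that B\<^sub>0(2) by (intro R) blast
  qed (use f_convex f_grad X_def g_convex Y p_pos c smooth strongly_convex mu_le_L solution
      step_sizes sampling run M\<^sub>f(3) M\<^sub>g q in blast)+
  show ?thesis
    using v_average_bound cond_exp_f_ge expectation_f_average_ge by blast
qed

end
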